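(* Let $X=(X_1,X_2)$ be a two-good random valuation with $X_1,X_2$ independent and each weakly regular. Then \[ \frac{\textsc{SRev}(X_1,X_2)}{\textsc{Rev}(X_1,X_2)}\;\geq\;\frac{e}{e+1}\approx 0.73 . \]
   Context: A one-dimensional random variable $X\ge 0$ is weakly regular if its support is an interval $[\alpha,\beta]$ with $0\le\alpha<\beta\le\infty$ (understood as $[\alpha,\infty)$ if $\beta=\infty$), on which it has a positive continuous density $f$, and the virtual valuation $t-G(t)/f(t)$ is nondecreasing on it, where $G(t)=\mathbb{P}[X\ge t]$. A $k$-good random valuation is a random vector $X$ in $\mathbb{R}_+^k$. A mechanism is a pair $\mu=(q,s)$ of Borel functions $q:\mathbb{R}_+^k\to[0,1]^k$, $s:\mathbb{R}_+^k\to\mathbb{R}$, with buyer payoff $b(x)=q(x)\cdot x-s(x)$; IR means $b(x)\ge0$ for all $x$; IC means $b(x)\ge q(\tilde x)\cdot x-s(\tilde x)$ for all $x,\tilde x$. $R(\mu;X)=\mathbb{E}[s(X)]$, $\textsc{Rev}(X)=\sup R(\mu;X)$ over IC and IR mechanisms, and $\textsc{SRev}(X)=\sum_i\textsc{Rev}(X_i)$. *)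

theory Defs
  imports "HOL-Probability.Probability"
begin

text \<open>Weak regularity of a one-dimensional random variable X on a probability space M:
  support is the interval [alpha, beta] (beta may be infinity, encoded as an extended real),
  with a positive continuous density f on it, and nondecreasing virtual valuation
  t - G t / f t, where G t = P[X \<ge> t].\<close>

definition support_interval :: "real \<Rightarrow> ereal \<Rightarrow> real set" where
  "support_interval \<alpha> \<beta> = {t. \<alpha> \<le> t \<and> ereal t \<le> \<beta>}"

definition weakly_regular :: "'a measure \<Rightarrow> ('a \<Rightarrow> real) \<Rightarrow> bool" where
  "weakly_regular M X \<longleftrightarrow>
     (\<exists>(\<alpha>::real) (\<beta>::ereal) (f::real \<Rightarrow> real).
        0 \<le> \<alpha> \<and> ereal \<alpha> < \<beta> \<and>
        distributed M lborel X (\<lambda>t. ennreal (indicator (support_interval \<alpha> \<beta>) t * f t)) \<and>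
        continuous_on (support_interval \<alpha> \<beta>) f \<and>
        (\<forall>t \<in> support_interval \<alpha> \<beta>. 0 < f t) \<and>
        mono_on (support_interval \<alpha> \<beta>)
          (\<lambda>t. t - prob_space.prob M {\<omega> \<in> space M. t \<le> X \<omega>} / f t))"

text \<open>Valuations for k goods live in R_+^k; we use the type real^'n with 'n a finite index type.\<close>

definition nonneg_orthant :: "(real^'n) set" where
  "nonneg_orthant = {x. \<forall>i. 0 \<le> x $ i}"

definition mechanism :: "(real^'n \<Rightarrow> real^'n) \<Rightarrow> (real^'n \<Rightarrow> real) \<Rightarrow> bool" where
  "mechanism q s \<longleftrightarrow> q \<in> borel_measurable borel \<and> s \<in> borel_measurable borel \<and>
     (\<forall>x i. 0 \<le> q x $ i \<and> q x $ i \<le> 1)"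

definition buyer_payoff :: "(real^'n \<Rightarrow> real^'n) \<Rightarrow> (real^'n \<Rightarrow> real) \<Rightarrow> real^'n \<Rightarrow> real" where
  "buyer_payoff q s x = q x \<bullet> x - s x"

definition IR :: "(real^'n \<Rightarrow> real^'n) \<Rightarrow> (real^'n \<Rightarrow> real) \<Rightarrow> bool" where
  "IR q s \<longleftrightarrow> (\<forall>x \<in> nonneg_orthant. 0 \<le> buyer_payoff q s x)"

definition IC :: "(real^'n \<Rightarrow> real^'n) \<Rightarrow> (real^'n \<Rightarrow> real) \<Rightarrow> bool" where
  "IC q s \<longleftrightarrow> (\<forall>x \<in> nonneg_orthant. \<forall>x' \<in> nonneg_orthant.
      q x' \<bullet> x - s x' \<le> buyer_payoff q s x)"

definition Rev :: "(real^'n) measure \<Rightarrow> real" where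
  "Rev D = Sup {integral\<^sup>L D s | q s. mechanism q s \<and> IC q s \<and> IR q s \<and> integrable D s}"

text \<open>Separate revenue of a random valuation X on M: sum of optimal revenues of each good alone
  (each good viewed as a 1-good valuation in real^1).\<close>
definition SRev :: "'a measure \<Rightarrow> ('a \<Rightarrow> real^'n) \<Rightarrow> real" where
  "SRev M X = (\<Sum>i\<in>UNIV. Rev (distr M borel (\<lambda>\<omega>. (\<chi> j::1. X \<omega> $ i))))"

end

theory Submission
  imports Defs "HOL-Real_Asymp.Real_Asymp"
begin

text \<open>Write good \<open>i\<close> as \<open>c\<^sub>i(u)\<close> for a uniform quantile \<open>u\<close>, and split the unit square of quantiles
  along its diagonal.  Where \<open>u < v\<close>, a payment \<open>s\<close> is the payment \<open>s - q\<^sub>2 c\<^sub>2(v)\<close> of a mechanism selling good 1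
  alone, plus \<open>q\<^sub>2 c\<^sub>2(v)\<close>.  By Myerson's argument for the first part and monotonicity of \<open>q\<^sub>2\<close> in its own good
  for the second, everything is bounded by quantities on the diagonal; symmetrically for \<open>v < u\<close>.
  With \<open>r\<^sub>i\<close> the revenue of good \<open>i\<close>, the diagonal terms combine to
  \<open>r\<^sub>1 + r\<^sub>2 + \<integral> q\<^sub>1 dV\<^sub>1 + \<integral> q\<^sub>2 dV\<^sub>2\<close>, where \<open>V\<^sub>i(u) = u (u c\<^sub>i(u) + \<integral>\<^sub>u\<^sup>1 c\<^sub>i - r\<^sub>i)\<close>.
  Since \<open>u c\<^sub>i(u) \<le> r\<^sub>i\<close>, we have \<open>V\<^sub>i(u) \<le> - r\<^sub>i u ln u \<le> r\<^sub>i / e\<close>; regularity makes \<open>V\<^sub>i\<close> concave, so with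
  \<open>0 \<le> q\<^sub>i \<le> 1\<close> each integral is at most \<open>max V\<^sub>i \<le> r\<^sub>i / e\<close>.\<close>

text \<open>The obstacle is the buyer's payoff \<open>B\<close> on the diagonal. Myerson's argument
  on a slice stops at the diagonal instead of at the lowest type, so each half of the square leaves
  a term \<open>- v * B v\<close>. Formally, the envelope formula gives
  \<open>B' = q1 * c1' + q2 * c2'\<close> along the diagonal, and
  \<open>u\<^sup>2 * c' u = u * (\<psi> u - c u)\<close>. Integrating
  \<open>- v\<^sup>2 * B'\<close> by parts then bounds twice the integral of \<open>v * B v\<close>
  from below by the integrals of \<open>q w w * (w * (c w - \<psi> w))\<close>, summed over the
  goods. Once this is subtracted, the coefficient of each allocation on the diagonal is exactly the
  derivative of its potential; this is where the formula for the potential comes from. In quantile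
  coordinates the scaling of \<open>w\<close> to \<open>\<mu> * w\<close> moves both goods along the
  diagonal at once, which lets a change of variables replace the derivative of \<open>B\<close>. A
  regular good may have infinite mean, so integrability always rests on the bound on
  \<open>u * c u\<close>, never on \<open>c\<close> alone.\<close>

section \<open>Single-good payments\<close>

text \<open>On the grid \<open>v, \<mu> v, \<mu>\<^sup>2 v, \<dots>\<close> the claim telescopes, up to a factor \<open>1 / \<mu>\<close> in front of \<open>r\<close>
  that disappears as \<open>\<mu> \<longrightarrow> 1\<close>; this avoids integrating by parts against the possibly
  non-integrable buyer payoff.\<close>

lemma antitone_payment_bound:
  fixes Q S c :: "real \<Rightarrow> real"
  assumes v: "0 < v"
    and S_le: "\<And>u w. \<lbrakk>0 < u; u \<le> w; w \<le> v\<rbrakk> \<Longrightarrow> S u \<le> S w + (Q u - Q w) * c u"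
    and S_anti: "\<And>u w. \<lbrakk>0 < u; u \<le> w; w \<le> v\<rbrakk> \<Longrightarrow> S w \<le> S u"
    and Q_anti: "\<And>u w. \<lbrakk>0 < u; u \<le> w; w \<le> v\<rbrakk> \<Longrightarrow> Q w \<le> Q u"
    and Q_le: "\<And>u. \<lbrakk>0 < u; u \<le> v\<rbrakk> \<Longrightarrow> Q u \<le> 1"
    and c_le: "\<And>u. \<lbrakk>0 < u; u \<le> v\<rbrakk> \<Longrightarrow> u * c u \<le> r"
    and r: "0 \<le> r"
    and int: "set_integrable lborel {0<..v} S"
  shows "(LINT u:{0<..v}|lborel. S u) \<le> v * S v + r * (1 - Q v)"
proof -
  have grid_bound: "(LINT u:{0<..v}|lborel. S u) \<le> v * S v + r / \<mu> * (1 - Q v)"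
    if \<mu>: "0 < \<mu>" "\<mu> < 1" for \<mu> :: real
  proof -
    define w where "w n = \<mu> ^ n * v" for n :: nat
    have w0: "w 0 = v" and w_Suc: "w (Suc n) = \<mu> * w n" for n
      by (simp_all add: w_def)
    have w_pos: "0 < w n" for n using \<mu> v by (simp add: w_def)
    have w_le: "w n \<le> v" for n using \<mu> v by (simp add: w_def mult_le_cancel_right1 power_le_one)
    have w_dec: "w (Suc n) < w n" for n using \<mu> w_pos[of n] by (simp add: w_Suc)
    have w_lim: "w \<longlonglongrightarrow> 0"
      unfolding w_def using LIMSEQ_power_zero[of \<mu>] \<mu> by (auto intro!: tendsto_eq_intros)
    have sub: "set_integrable lborel {a<..b} S" if "0 \<le> a" "b \<le> v" for a b
      by (rule set_integrable_subset[OF int]) (use that in auto)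
    \<comment> \<open>Discrete integration by parts: each cell contributes at most its width times
      the payment at its left end, and increments of \<open>S\<close> are paid for by increments of
      \<open>Q\<close>.\<close>
    have partial: "(LINT u:{w n<..v}|lborel. S u)
        \<le> v * S v - w n * S (w n) + r / \<mu> * (Q (w n) - Q v)" for n
    proof (induction n)
      case 0
      show ?case by (simp add: w0 set_lebesgue_integral_def)
    next
      case (Suc n)
      have "(LINT u:{w (Suc n)<..v}|lborel. S u)
          = (LINT u:{w (Suc n)<..w n} \<union> {w n<..v}|lborel. S u)"
        using w_dec[of n] w_le[of n] by (intro arg_cong[where f = "\<lambda>A. set_lebesgue_integral lborel A S"]) auto
      also have "\<dots> = (LINT u:{w (Suc n)<..w n}|lborel. S u) + (LINT u:{w n<..v}|lborel. S u)"
        using w_pos w_le by (intro set_integral_Un sub) (auto simp: less_imp_le)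
      also have "(LINT u:{w (Suc n)<..w n}|lborel. S u)
          \<le> (LINT u:{w (Suc n)<..w n}|lborel. S (w (Suc n)))"
        using w_pos[of "Suc n"] w_le[of n] w_dec[of n]
        by (intro set_integral_mono sub S_anti) (auto simp: set_integrable_def less_imp_le)
      also have "\<dots> = (w n - w (Suc n)) * S (w (Suc n))"
        using w_dec[of n] by (simp add: set_integral_const)
      finally have step: "(LINT u:{w (Suc n)<..v}|lborel. S u)
          \<le> (w n - w (Suc n)) * S (w (Suc n)) + (LINT u:{w n<..v}|lborel. S u)" by simp
      \<comment> \<open>Since \<open>w n\<close> is \<open>w (Suc n) / \<mu>\<close>, the product
        with \<open>c (w (Suc n))\<close> is a revenue divided by \<open>\<mu>\<close>. This
        mismatch by one cell is the only source of the factor \<open>1 / \<mu>\<close>.\<close>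
      have "w n * (S (w (Suc n)) - S (w n)) \<le> w n * ((Q (w (Suc n)) - Q (w n)) * c (w (Suc n)))"
        using S_le[of "w (Suc n)" "w n"] w_pos w_le w_dec by (intro mult_left_mono) (auto simp: less_imp_le)
      also have "\<dots> = (Q (w (Suc n)) - Q (w n)) * (w (Suc n) * c (w (Suc n))) / \<mu>"
        using \<mu> by (simp add: w_Suc)
      also have "\<dots> \<le> (Q (w (Suc n)) - Q (w n)) * r / \<mu>"
        using Q_anti[of "w (Suc n)" "w n"] c_le[of "w (Suc n)"] w_pos w_le w_dec[of n] \<mu>
        by (intro divide_right_mono mult_left_mono) (auto simp: less_imp_le)
      finally show ?case using step Suc by (simp add: algebra_simps diff_divide_distrib)
    qed
    \<comment> \<open>\<open>S (w n)\<close> may grow without bound, but only its lower bound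
      \<open>S v\<close> is needed, and with that constant the boundary term vanishes in the
      limit.\<close>
    have "(LINT u:{w n<..v}|lborel. S u) \<le> v * S v - w n * S v + r / \<mu> * (1 - Q v)" for n
    proof -
      have "w n * S v \<le> w n * S (w n)"
        using S_anti[of "w n" v] w_pos[of n] w_le[of n] by (intro mult_left_mono) auto
      moreover have "r / \<mu> * (Q (w n) - Q v) \<le> r / \<mu> * (1 - Q v)"
        using Q_le[of "w n"] w_pos[of n] w_le[of n] \<mu> r by (intro mult_left_mono) auto
      ultimately show ?thesis using partial[of n] by linarith
    qed
    moreover have "(\<lambda>n. LINT u:{w n<..v}|lborel. S u) \<longlonglongrightarrow> (LINT u:(\<Union>n. {w n<..v})|lborel. S u)"
      and U: "(\<Union>n. {w n<..v}) = {0<..v}"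
    proof -
      show U: "(\<Union>n. {w n<..v}) = {0<..v}"
        using order_tendstoD(2)[OF w_lim] w_pos
        by (auto simp: eventually_sequentially) (metis order_less_trans, fastforce)
      have "incseq (\<lambda>n. {w n<..v})"
        by (rule incseq_SucI) (auto intro: less_trans[OF w_dec])
      then show "(\<lambda>n. LINT u:{w n<..v}|lborel. S u) \<longlonglongrightarrow> (LINT u:(\<Union>n. {w n<..v})|lborel. S u)"
        using int U by (intro set_integral_cont_up) auto
    qed
    moreover have "(\<lambda>n. v * S v - w n * S v + r / \<mu> * (1 - Q v)) \<longlonglongrightarrow> v * S v - 0 * S v + r / \<mu> * (1 - Q v)"
      by (intro tendsto_intros w_lim)
    ultimately show ?thesis
      by (auto intro: LIMSEQ_le)
  qed
  have "((\<lambda>\<mu>. v * S v + r / \<mu> * (1 - Q v)) \<longlongrightarrow> v * S v + r / 1 * (1 - Q v)) (at_left 1)"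
    by (intro tendsto_intros) auto
  moreover have "eventually (\<lambda>\<mu>. (LINT u:{0<..v}|lborel. S u) \<le> v * S v + r / \<mu> * (1 - Q v)) (at_left (1::real))"
    by (rule eventually_mono[OF eventually_at_left_real[of 0 1]], simp, rule grid_bound) auto
  ultimately show ?thesis
    using tendsto_lowerbound[of _ _ "at_left (1::real)"] by fastforce
qed

section \<open>Quantile functions of regular goods\<close>

abbreviation unif :: "real measure" where
  "unif \<equiv> restrict_space lborel {0<..<1}"

lemma space_unif [simp]: "space unif = {0<..<1}"
  by (simp add: space_restrict_space)

lemma prob_space_unif: "prob_space unif"
  by (rule prob_spaceI) (simp add: emeasure_restrict_space space_restrict_space)

interpretation unif: prob_space unif
  by (rule prob_space_unif)

interpretation unif2: pair_prob_space unif unif ..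

lemma measurable_unif_ident [measurable]: "(\<lambda>x. x) \<in> borel_measurable unif"
  by (rule measurable_restrict_space1) simp

lemma unif_set_integral:
  assumes "A \<subseteq> {0<..<1}"
  shows "(\<integral>u. indicator A u * f u \<partial>unif) = (LINT u:A|lborel. f u :: real)"
proof -
  have eq: "(\<lambda>u. indicator {0<..<1} u *\<^sub>R (indicator A u * f u)) = (\<lambda>u. indicator A u *\<^sub>R f u)"
    using assms by (auto intro!: ext split: split_indicator)
  show ?thesis
    by (subst integral_restrict_space) (simp, simp only: eq set_lebesgue_integral_def)
qed

lemma unif_set_integrable:
  assumes "A \<subseteq> {0<..<1}"
  shows "integrable unif (\<lambda>u. indicator A u * f u) \<longleftrightarrow> set_integrable lborel A (f :: real \<Rightarrow> real)"
proof -
  have eq: "(\<lambda>u. indicator {0<..<1} u *\<^sub>R (indicator A u * f u)) = (\<lambda>u. indicator A u *\<^sub>R f u)"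
    using assms by (auto intro!: ext split: split_indicator)
  show ?thesis
    by (subst integrable_restrict_space) (simp, simp only: eq set_integrable_def)
qed

lemma borel_measurable_antitone_unif:
  fixes g :: "real \<Rightarrow> real"
  assumes "\<And>u w. \<lbrakk>0 < u; u \<le> w; w < 1\<rbrakk> \<Longrightarrow> g w \<le> g u"
  shows "g \<in> borel_measurable unif"
proof -
  have "(\<lambda>u. - g u) \<in> borel_measurable (restrict_space borel {0<..<1})"
    by (rule borel_measurable_mono_on_fnc) (auto intro!: mono_onI assms)
  then have "(\<lambda>u. - g u) \<in> borel_measurable unif"
    by (simp add: measurable_def space_restrict_space sets_restrict_space)
  then have "(\<lambda>u. - (- g u)) \<in> borel_measurable unif" by measurable
  then show ?thesis by simp
qed

lemma nn_integral_unif_lessThan: "(\<integral>\<^sup>+u. indicator {..<v} u \<partial>unif) = ennreal v" if "0 < v" "v < 1" for v :: real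
proof -
  have eq: "(\<lambda>u. indicator {..<v} u * indicator {0<..<1} u :: ennreal) = indicator {0<..<v}"
    using that by (auto split: split_indicator)
  have "(\<integral>\<^sup>+u. indicator {..<v} u \<partial>unif) = (\<integral>\<^sup>+u. indicator {0<..<v} u \<partial>lborel)"
    by (subst nn_integral_restrict_space) (simp, simp only: eq)
  then show ?thesis using that by simp
qed

lemma integrable_unif_bounded_times:
  assumes "integrable unif g" "f \<in> borel_measurable unif"
    and "\<And>v. v \<in> {0<..<1} \<Longrightarrow> 0 \<le> f v \<and> f v \<le> 1"
  shows "integrable unif (\<lambda>v. f v * g v :: real)"
  by (rule Bochner_Integration.integrable_bound[OF assms(1)])
    (use assms in \<open>auto intro!: AE_I2 mult_left_le_one_le simp: abs_mult\<close>)

text \<open>The substitution has Jacobian \<open>\<mu>\<close> and maps the unit interval onto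
  \<open>{0<..<\<mu>}\<close>; the part of the integral beyond \<open>\<mu>\<close> is nonnegative
  and is dropped.\<close>

lemma nn_integral_unif_scale_le:
  fixes f :: "real \<Rightarrow> real"
  assumes f: "f \<in> borel_measurable unif" and \<mu>: "0 < \<mu>" "\<mu> < 1"
  shows "ennreal \<mu> * (\<integral>\<^sup>+w. f (\<mu> * w) \<partial>unif) \<le> (\<integral>\<^sup>+w. f w \<partial>unif)"
proof -
  let ?g = "\<lambda>w. ennreal (f w) * indicator {0<..<1} w"
  let ?h = "\<lambda>w. ?g w * indicator {0<..<\<mu>} w"
  have "(\<lambda>w. ennreal (f w)) \<in> borel_measurable unif" using f by measurable
  then have g [measurable]: "?g \<in> borel_measurable borel"
    by (subst (asm) borel_measurable_restrict_space_iff_ennreal) auto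
  have "(\<integral>\<^sup>+w. f (\<mu> * w) \<partial>unif) = (\<integral>\<^sup>+w. ennreal (f (\<mu> * w)) * indicator {0<..<1} w \<partial>lborel)"
    by (rule nn_integral_restrict_space) simp
  also have "\<dots> = (\<integral>\<^sup>+w. ?h (0 + \<mu> * w) \<partial>lborel)"
    using \<mu> by (intro nn_integral_cong)
      (auto split: split_indicator simp: zero_less_mult_iff mult_less_cancel_left2 dest: mult_strict_mono)
  finally have "ennreal \<mu> * (\<integral>\<^sup>+w. f (\<mu> * w) \<partial>unif) = (\<integral>\<^sup>+w. ?h w \<partial>lborel)"
    using nn_integral_real_affine[of ?h \<mu> 0] \<mu> by simp
  also have "\<dots> \<le> (\<integral>\<^sup>+w. ?g w \<partial>lborel)"
    by (intro nn_integral_mono) (auto split: split_indicator)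
  also have "\<dots> = (\<integral>\<^sup>+w. f w \<partial>unif)"
    by (rule nn_integral_restrict_space[symmetric]) simp
  finally show ?thesis .
qed

text \<open>Here \<open>c u\<close> is the value exceeded with probability \<open>u\<close>, so \<open>u * c u\<close> is the revenue of the price \<open>c u\<close>
  and its derivative \<open>\<psi> u\<close> is the virtual valuation at \<open>c u\<close>; weak regularity says that \<open>\<psi>\<close> decreases.\<close>

locale regular_quantile =
  fixes c \<psi> :: "real \<Rightarrow> real" and r :: real
  assumes c_nonneg: "\<lbrakk>0 < u; u < 1\<rbrakk> \<Longrightarrow> 0 \<le> c u"
    and c_strict_anti: "\<lbrakk>0 < u; u < w; w < 1\<rbrakk> \<Longrightarrow> c w < c u"
    and c_deriv: "\<lbrakk>0 < u; u < 1\<rbrakk> \<Longrightarrow> (c has_real_derivative (\<psi> u - c u) / u) (at u)"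
    and \<psi>_anti: "\<lbrakk>0 < u; u \<le> w; w < 1\<rbrakk> \<Longrightarrow> \<psi> w \<le> \<psi> u"
    and \<psi>_continuous: "continuous_on {0<..<1} \<psi>"
    and revenue_le: "\<lbrakk>0 < u; u < 1\<rbrakk> \<Longrightarrow> u * c u \<le> r"
begin

text \<open>Large quantiles are small values, so this is the contribution to the mean of all values
  below \<open>c u\<close>. It arises when \<open>q2 u v * c2 v\<close> is integrated over
  \<open>v\<close> with \<open>q2 u v\<close> replaced by its diagonal value.\<close>

definition K :: "real \<Rightarrow> real" where
  "K u = (\<integral>w. indicator {u<..} w * c w \<partial>unif)"

lemma c_anti: "\<lbrakk>0 < u; u \<le> w; w < 1\<rbrakk> \<Longrightarrow> c w \<le> c u"
  using c_strict_anti[of u w] by (cases "u = w") auto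

lemma r_nonneg: "0 \<le> r"
  using revenue_le[of "1/2"] c_nonneg[of "1/2"] by simp

lemma c_le: "\<lbrakk>0 < u; u < 1\<rbrakk> \<Longrightarrow> c u \<le> r / u"
  using revenue_le[of u] by (simp add: field_simps)

text \<open>The slope of \<open>c\<close> is \<open>(\<psi> u - c u) / u\<close>, and a decreasing
  function has no positive slope.\<close>

lemma \<psi>_le_c: "\<psi> u \<le> c u" if u: "0 < u" "u < 1"
proof (rule ccontr)
  assume "\<not> \<psi> u \<le> c u"
  then have "0 < (\<psi> u - c u) / u" using u by simp
  from DERIV_pos_inc_right[OF c_deriv[OF u] this] obtain d where
    d: "0 < d" "\<And>h. \<lbrakk>0 < h; h < d\<rbrakk> \<Longrightarrow> c u < c (u + h)" by blast
  define h where "h = min d (1 - u) / 2"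
  have "0 < h" "h < d" "u + h < 1" using d u by (auto simp: h_def min_def field_simps)
  then show False using d(2)[of h] c_strict_anti[of u "u + h"] u by simp
qed

lemma c_measurable [measurable]: "c \<in> borel_measurable unif"
  by (rule borel_measurable_antitone_unif) (rule c_anti)

lemma \<psi>_measurable [measurable]: "\<psi> \<in> borel_measurable unif"
  by (rule borel_measurable_antitone_unif) (rule \<psi>_anti)

lemma integrable_revenue: "integrable unif (\<lambda>u. u * c u)"
  by (rule unif.integrable_const_bound[where B = r])
    (use revenue_le c_nonneg in \<open>auto intro!: AE_I2 simp: abs_mult\<close>)

text \<open>By Tonelli, integrating over \<open>u\<close> first turns \<open>c v\<close> into
  \<open>v * c v\<close>, which is bounded. Hence the triangle is harmless even when the mean of the
  good is infinite.\<close>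

lemma integrable_triangle: "integrable (unif \<Otimes>\<^sub>M unif) (\<lambda>(u, v). indicator {u<..} v * c v)"
proof -
  have meas [measurable]: "(\<lambda>(u, v). indicator {u<..} v * c v) \<in> borel_measurable (unif \<Otimes>\<^sub>M unif)"
  proof -
    have "(\<lambda>(u, v). indicator {u<..} v * c v) = (\<lambda>p. (if fst p < snd p then c (snd p) else 0))"
      by (auto simp: fun_eq_iff)
    then show ?thesis by simp
  qed
  have "(\<integral>\<^sup>+p. norm (case p of (u, v) \<Rightarrow> indicator {u<..} v * c v) \<partial>(unif \<Otimes>\<^sub>M unif))
      = (\<integral>\<^sup>+v. \<integral>\<^sup>+u. norm (indicator {u<..} v * c v) \<partial>unif \<partial>unif)"
    by (subst unif2.nn_integral_snd[symmetric]) (use meas in \<open>auto simp: split_beta'\<close>)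
  also have "\<dots> = (\<integral>\<^sup>+v. ennreal (v * c v) \<partial>unif)"
  proof (intro nn_integral_cong)
    fix v assume "v \<in> space unif"
    then have v: "0 < v" "v < 1" by auto
    have "(\<integral>\<^sup>+u. norm (indicator {u<..} v * c v) \<partial>unif) = (\<integral>\<^sup>+u. ennreal (c v) * indicator {..<v} u \<partial>unif)"
      using c_nonneg[OF v] by (intro nn_integral_cong) (auto split: split_indicator)
    also have "\<dots> = ennreal (c v) * ennreal v"
      by (subst nn_integral_cmult) (simp_all add: nn_integral_unif_lessThan v)
    finally show "(\<integral>\<^sup>+u. norm (indicator {u<..} v * c v) \<partial>unif) = ennreal (v * c v)"
      using v c_nonneg[OF v] by (simp add: ennreal_mult' mult.commute)
  qed
  also have "\<dots> < \<infinity>"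
    using integrable_revenue by (subst nn_integral_eq_integral) (auto simp: c_nonneg)
  finally show ?thesis
    by (intro integrableI_bounded meas)
qed

lemma integrable_K: "integrable unif K"
  unfolding K_def [abs_def] by (rule unif2.integrable_fst[OF integrable_triangle])

lemma set_integrable_c: "set_integrable lborel A c" if "0 < a" "A \<subseteq> {a..<1}" "A \<in> sets borel"
proof -
  have A: "A \<subseteq> {0<..<1}" using that by force
  have "integrable unif (\<lambda>u. indicator A u * c u)"
  proof (rule unif.integrable_const_bound[where B = "r / a"])
    show "AE u in unif. norm (indicator A u * c u) \<le> r / a"
    proof (rule AE_I2)
      fix u :: real assume "u \<in> space unif"
      then have u: "0 < u" "u < 1" by auto
      show "norm (indicator A u * c u) \<le> r / a"
      proof (cases "u \<in> A")
        case True
        then have "a \<le> u" using that by auto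
        then have "r / u \<le> r / a" using that(1) r_nonneg by (intro divide_left_mono) auto
        then show ?thesis using c_le[OF u] c_nonneg[OF u] True by simp
      qed (use r_nonneg that in auto)
    qed
    have "A \<inter> {0<..<1} \<in> sets unif" using that by (auto simp: sets_restrict_space)
    then have "A \<in> sets unif" using A by (simp add: Int_absorb2)
    then show "(\<lambda>u. indicator A u * c u) \<in> borel_measurable unif" by measurable
  qed
  then show ?thesis by (simp add: unif_set_integrable[OF A])
qed

lemma K_eq: "K u = (LINT w:{u<..<1}|lborel. c w)" if "0 < u"
proof -
  have "K u = (\<integral>w. indicator {u<..<1} w * c w \<partial>unif)"
    unfolding K_def by (intro Bochner_Integration.integral_cong) (auto split: split_indicator)
  also have "\<dots> = (LINT w:{u<..<1}|lborel. c w)"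
    using that by (intro unif_set_integral) auto
  finally show ?thesis .
qed

lemma K_nonneg: "0 \<le> K u"
  unfolding K_def by (intro Bochner_Integration.integral_nonneg) (auto simp: c_nonneg)

lemma K_split: "K u = (LINT w:{u<..b}|lborel. c w) + K b" if "0 < u" "u \<le> b" "b < 1"
proof -
  have "{u<..<1} = {u<..b} \<union> {b<..<1}" using that by auto
  then show ?thesis
    using that by (simp add: K_eq) (intro set_integral_Un set_integrable_c[of u], auto)
qed

lemma K_le: "K u \<le> - r * ln u" if u: "0 < u" "u < 1"
proof -
  have *: "has_bochner_integral lborel (\<lambda>w. r / w * indicator {u..1} w) (r * ln 1 - r * ln u)"
    using u r_nonneg
    by (intro has_bochner_integral_FTC_Icc_real) (auto intro!: derivative_eq_intros isCont_divide)
  have "K u = (\<integral>w. indicator {u<..<1} w * c w \<partial>lborel)"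
    using u by (simp add: K_eq set_lebesgue_integral_def)
  also have "\<dots> \<le> (\<integral>w. r / w * indicator {u..1} w \<partial>lborel)"
  proof (rule integral_mono)
    show "integrable lborel (\<lambda>w. indicator {u<..<1} w * c w)"
      using set_integrable_c[of u "{u<..<1}"] u by (simp add: set_integrable_def greaterThanLessThan_subseteq_atLeastLessThan_iff)
    show "integrable lborel (\<lambda>w. r / w * indicator {u..1} w)"
      using * by (rule integrable.intros)
    fix w show "indicator {u<..<1} w * c w \<le> r / w * indicator {u..1} w"
      using u c_le[of w] r_nonneg by (auto split: split_indicator)
  qed
  also have "\<dots> = r * ln 1 - r * ln u"
    using * by (rule has_bochner_integral_integral_eq)
  finally show ?thesis by simp
qed

lemma c_continuous: "continuous_on {0<..<1} c"
  by (rule continuous_at_imp_continuous_on) (auto intro!: DERIV_isCont c_deriv)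

lemma K_deriv: "(K has_real_derivative - c u) (at u)" if u: "0 < u" "u < 1"
proof -
  \<comment> \<open>\<open>c\<close> is controlled on the open interval only, so the fundamental
    theorem is applied on a compact neighbourhood of \<open>u\<close>; the tail beyond
    \<open>b\<close> is the constant \<open>K b\<close>.\<close>
  define a b where "a = u / 2" and "b = (1 + u) / 2"
  have ab: "0 < a" "a < u" "u < b" "b < 1" using u by (auto simp: a_def b_def)
  have cont: "continuous_on {a..b} c"
    by (rule continuous_on_subset[OF c_continuous]) (use ab in auto)
  have K: "K x = integral {x..b} c + K b" if "x \<in> {a<..<b}" for x
  proof -
    have "(LINT w:{x<..b}|lborel. c w) = (LINT w:{x..b}|lborel. c w)"
      unfolding set_lebesgue_integral_def
    proof (rule integral_cong_AE)
      have "set_integrable lborel {x<..b} c" "set_integrable lborel {x..b} c"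
        using that ab by (auto intro!: set_integrable_c[of x])
      then show "(\<lambda>w. indicator {x<..b} w *\<^sub>R c w) \<in> borel_measurable lborel"
        "(\<lambda>w. indicator {x..b} w *\<^sub>R c w) \<in> borel_measurable lborel"
        unfolding set_integrable_def by (auto dest: borel_measurable_integrable)
      show "AE w in lborel. indicator {x<..b} w *\<^sub>R c w = indicator {x..b} w *\<^sub>R c w"
        using AE_lborel_singleton[of x] by eventually_elim (auto split: split_indicator)
    qed
    also have "\<dots> = integral {x..b} c"
      using that ab by (intro set_borel_integral_eq_integral(2) set_integrable_c[of x]) auto
    finally show ?thesis using K_split[of x b] that ab by simp
  qed
  have "((\<lambda>x. integral {x..b} c) has_real_derivative - c u) (at u within {a..b})"
    using cont ab by (intro integral_has_real_derivative') auto
  then have "((\<lambda>x. integral {x..b} c + K b) has_real_derivative - c u) (at u within {a<..<b})"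
    by (auto intro!: derivative_eq_intros intro: DERIV_subset[of _ _ _ "{a..b}"])
  then have "((\<lambda>x. integral {x..b} c + K b) has_real_derivative - c u) (at u)"
    using ab by (simp add: at_within_open[of u "{a<..<b}"])
  then show ?thesis
    by (rule has_field_derivative_transform_within_open[of _ _ _ "{a<..<b}"]) (use K ab in auto)
qed

text \<open>\<open>V\<close> is the potential increase in revenue caused by switching on the diagonal at quantile \<open>u\<close>, and \<open>D\<close> is
  its derivative.  Regularity makes \<open>V\<close> concave, which replaces the (unavailable) monotonicity of the
  allocation along the diagonal.\<close>

definition D :: "real \<Rightarrow> real" where
  "D u = u * \<psi> u + K u - r"

definition V :: "real \<Rightarrow> real" where
  "V u = u * (u * c u + K u - r)"

text \<open>Concavity of \<open>V\<close>. Formally \<open>D' = \<psi> + u * \<psi>' - c\<close>,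
  where \<open>\<psi> - c\<close> and \<open>\<psi>'\<close> are both at most 0. As
  \<open>\<psi>\<close> need not be differentiable, the same computation is done with
  differences.\<close>

lemma D_anti: "D w \<le> D u" if uw: "0 < u" "u \<le> w" "w < 1"
proof -
  have "(w - u) * c w = (LINT x:{u<..w}|lborel. c w)"
    using uw by (simp add: set_integral_const)
  also have "\<dots> \<le> (LINT x:{u<..w}|lborel. c x)"
    using uw by (intro set_integral_mono set_integrable_c[of u]) (auto simp: set_integrable_def intro: c_anti)
  finally have "(w - u) * c w \<le> K u - K w" using K_split[of u w] uw by simp
  moreover have "(w - u) * \<psi> w \<le> (w - u) * c w"
    using \<psi>_le_c[of w] uw by (intro mult_left_mono) auto
  moreover have "u * \<psi> w \<le> u * \<psi> u" using \<psi>_anti uw by (intro mult_left_mono) auto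
  ultimately show ?thesis by (simp add: D_def algebra_simps)
qed

lemma V_deriv: "(V has_real_derivative D u) (at u)" if "0 < u" "u < 1"
  unfolding V_def [abs_def] D_def
  by (rule derivative_eq_intros c_deriv K_deriv that refl)+ (use that in \<open>simp add: field_simps\<close>)

lemma V_ge: "- u * r \<le> V u" if "0 < u" "u < 1"
proof -
  have "u * (- r) \<le> V u"
    unfolding V_def using that K_nonneg c_nonneg by (intro mult_left_mono) auto
  then show ?thesis by simp
qed

lemma V_le: "V u \<le> r / exp 1" if u: "0 < u" "u < 1"
proof -
  have "V u \<le> u * (- r * ln u)"
    unfolding V_def using u K_le[OF u] revenue_le[OF u] by (intro mult_left_mono) auto
  also have "\<dots> = r * (u * ln (1 / u))" using u by (simp add: ln_div)
  also have "u * ln (1 / u) \<le> 1 / exp 1"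
  proof -
    \<comment> \<open>The tangent bound \<open>ln x \<le> x - 1\<close>, taken at the point that
      makes it an equality at the maximiser \<open>u = 1 / exp 1\<close>.\<close>
    have "ln (1 / (exp 1 * u)) \<le> 1 / (exp 1 * u) - 1"
      using u by (intro ln_le_minus_one) auto
    then have "ln (1 / u) \<le> 1 / (exp 1 * u)" using u by (simp add: ln_div ln_mult)
    then have "u * ln (1 / u) \<le> u * (1 / (exp 1 * u))" using u by (intro mult_left_mono) auto
    then show ?thesis using u by simp
  qed
  finally show ?thesis using r_nonneg by (simp add: mult_left_mono)
qed

lemma D_continuous: "continuous_on {0<..<1} D"
proof -
  have "continuous_on {0<..<1} K"
    by (rule continuous_at_imp_continuous_on) (auto intro!: DERIV_isCont K_deriv)
  then show ?thesis
    unfolding D_def [abs_def] by (intro continuous_intros \<psi>_continuous)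
qed

text \<open>Since \<open>D\<close> changes sign at most once, from plus to minus, the best weight
  \<open>Q\<close> is the indicator of the part where \<open>D\<close> is nonnegative, and there the
  integral is a difference of values of \<open>V\<close>. The term \<open>\<epsilon> * r\<close>
  comes from the lower bound on \<open>V \<epsilon>\<close>.\<close>

lemma integral_Icc_D_le:
  assumes \<epsilon>: "0 < \<epsilon>" "\<epsilon> \<le> w" "w < 1"
    and Q: "\<And>u. \<lbrakk>0 < u; u < 1\<rbrakk> \<Longrightarrow> 0 \<le> Q u \<and> Q u \<le> 1"
    and int: "integrable unif (\<lambda>u. indicator {\<epsilon>..w} u * (Q u * D u))"
  shows "(\<integral>u. indicator {\<epsilon>..w} u * (Q u * D u) \<partial>unif) \<le> r / exp 1 + \<epsilon> * r"
proof (cases "0 \<le> D \<epsilon>")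
  case False
  have "0 \<le> (\<integral>u. - (indicator {\<epsilon>..w} u * (Q u * D u)) \<partial>unif)"
  proof (rule Bochner_Integration.integral_nonneg)
    fix u assume "u \<in> space unif"
    then show "0 \<le> - (indicator {\<epsilon>..w} u * (Q u * D u))"
      using False D_anti[of \<epsilon> u] \<epsilon> Q[of u] by (auto split: split_indicator intro!: mult_nonneg_nonpos)
  qed
  then have "(\<integral>u. indicator {\<epsilon>..w} u * (Q u * D u) \<partial>unif) \<le> 0" by simp
  then show ?thesis using r_nonneg \<epsilon> by (smt (verit) divide_nonneg_pos exp_gt_zero mult_nonneg_nonneg)
next
  case True
  \<comment> \<open>The switching point: a zero of \<open>D\<close> from the intermediate value
    theorem, or the right end if \<open>D\<close> stays nonnegative.\<close>
  obtain v where v: "\<epsilon> \<le> v" "v \<le> w" "0 \<le> D v" "v = w \<or> D v = 0"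
  proof (cases "0 \<le> D w")
    case False
    have "\<exists>x\<ge>\<epsilon>. x \<le> w \<and> D x = 0"
      using \<epsilon> True False by (intro IVT2' continuous_on_subset[OF D_continuous]) auto
    then show ?thesis using that by auto
  qed (use \<epsilon> that in auto)
  have FTC: "has_bochner_integral lborel (\<lambda>u. D u * indicator {\<epsilon>..v} u) (V v - V \<epsilon>)"
  proof (rule has_bochner_integral_FTC_Icc_real)
    fix u assume "\<epsilon> \<le> u" "u \<le> v"
    then have u: "u \<in> {0<..<1}" using \<epsilon> v by auto
    then show "(V has_real_derivative D u) (at u)" by (intro V_deriv) auto
    show "isCont D u" using D_continuous u by (simp add: continuous_on_eq_continuous_at)
  qed (use v in auto)
  have sub: "{\<epsilon>..v} \<subseteq> {0<..<1}" using \<epsilon> v by auto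
  have "(\<integral>u. indicator {\<epsilon>..w} u * (Q u * D u) \<partial>unif) \<le> (\<integral>u. indicator {\<epsilon>..v} u * D u \<partial>unif)"
  proof (rule integral_mono[OF int])
    show "integrable unif (\<lambda>u. indicator {\<epsilon>..v} u * D u)"
      using FTC unif_set_integrable[OF sub, of D]
      by (simp add: set_integrable_def has_bochner_integral_iff mult.commute)
    fix u assume "u \<in> space unif"
    then have u: "0 < u" "u < 1" by auto
    show "indicator {\<epsilon>..w} u * (Q u * D u) \<le> indicator {\<epsilon>..v} u * D u"
    proof (cases "u \<le> v")
      case True
      then have "0 \<le> D u" using D_anti[of u v] v u \<epsilon> by auto
      then show ?thesis
        using Q[OF u] True v by (auto split: split_indicator simp: mult_left_le_one_le)
    next
      case False
      then have "u \<le> w \<Longrightarrow> D u \<le> 0" using D_anti[of v u] v u \<epsilon> by auto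
      then show ?thesis
        using Q[OF u] False by (auto split: split_indicator intro!: mult_nonneg_nonpos)
    qed
  qed
  also have "\<dots> = V v - V \<epsilon>"
    using FTC unif_set_integral[OF sub, of D]
    by (simp add: set_lebesgue_integral_def has_bochner_integral_iff mult.commute)
  also have "\<dots> \<le> r / exp 1 + \<epsilon> * r"
    using V_le[of v] V_ge[of \<epsilon>] \<epsilon> v by simp
  finally show ?thesis .
qed

lemma integral_D_le:
  assumes Q: "\<And>u. \<lbrakk>0 < u; u < 1\<rbrakk> \<Longrightarrow> 0 \<le> Q u \<and> Q u \<le> 1"
    and int: "integrable unif (\<lambda>u. Q u * D u)"
  shows "(\<integral>u. Q u * D u \<partial>unif) \<le> r / exp 1"
proof -
  \<comment> \<open>The shift by 2 keeps \<open>\<epsilon> n\<close> at most 1/2, so that the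
    truncated interval is nonempty from the start.\<close>
  define \<epsilon> where "\<epsilon> n = 1 / (real n + 2)" for n
  have \<epsilon>: "0 < \<epsilon> n" "\<epsilon> n \<le> 1 - \<epsilon> n" "1 - \<epsilon> n < 1" for n
    by (auto simp: \<epsilon>_def field_simps)
  have \<epsilon>_lim: "\<epsilon> \<longlonglongrightarrow> 0" unfolding \<epsilon>_def by real_asymp
  have int_n: "integrable unif (\<lambda>u. indicator {\<epsilon> n..1 - \<epsilon> n} u * (Q u * D u))" for n
  proof (rule Bochner_Integration.integrable_bound[OF int])
    have "(\<lambda>u. indicator {\<epsilon> n..1 - \<epsilon> n} u :: real) \<in> borel_measurable unif"
      by (rule measurable_restrict_space1) simp
    then show "(\<lambda>u. indicator {\<epsilon> n..1 - \<epsilon> n} u * (Q u * D u)) \<in> borel_measurable unif"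
      by (rule borel_measurable_times[OF _ borel_measurable_integrable[OF int]])
  qed (auto split: split_indicator)
  have "(\<lambda>n. \<integral>u. indicator {\<epsilon> n..1 - \<epsilon> n} u * (Q u * D u) \<partial>unif) \<longlonglongrightarrow> (\<integral>u. Q u * D u \<partial>unif)"
  proof (rule integral_dominated_convergence[where w = "\<lambda>u. \<bar>Q u * D u\<bar>"])
    show "AE u in unif. (\<lambda>n. indicator {\<epsilon> n..1 - \<epsilon> n} u * (Q u * D u)) \<longlonglongrightarrow> Q u * D u"
    proof (rule AE_I2)
      fix u assume "u \<in> space unif"
      then have "0 < u" "0 < 1 - u" by auto
      from order_tendstoD(2)[OF \<epsilon>_lim this(1)] order_tendstoD(2)[OF \<epsilon>_lim this(2)]
      have "eventually (\<lambda>n. indicator {\<epsilon> n..1 - \<epsilon> n} u * (Q u * D u) = Q u * D u) sequentially"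
        by eventually_elim auto
      then show "(\<lambda>n. indicator {\<epsilon> n..1 - \<epsilon> n} u * (Q u * D u)) \<longlonglongrightarrow> Q u * D u"
        by (rule tendsto_eventually)
    qed
    show "(\<lambda>u. Q u * D u) \<in> borel_measurable unif" using int by auto
    show "(\<lambda>u. indicator {\<epsilon> n..1 - \<epsilon> n} u * (Q u * D u)) \<in> borel_measurable unif" for n
      using int_n by auto
    show "integrable unif (\<lambda>u. \<bar>Q u * D u\<bar>)" using int by auto
  qed (auto split: split_indicator)
  moreover have "(\<lambda>n. r / exp 1 + \<epsilon> n * r) \<longlonglongrightarrow> r / exp 1 + 0 * r"
    by (intro tendsto_intros \<epsilon>_lim)
  ultimately have "(\<integral>u. Q u * D u \<partial>unif) \<le> r / exp 1 + 0 * r"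
    by (rule LIMSEQ_le) (use integral_Icc_D_le[OF \<epsilon> Q int_n] in auto)
  then show ?thesis by simp
qed

text \<open>The limit is \<open>- w\<^sup>2\<close> times the derivative of \<open>c\<close>. The
  increment of the argument is \<open>(\<mu> n - 1) * w\<close>, and the weight behaves like
  \<open>1 / (2 * (1 - \<mu> n))\<close>, which the factor 2 compensates.\<close>

lemma tendsto_scaled_difference:
  assumes w: "0 < w" "w < 1" and \<mu>: "\<mu> \<longlonglongrightarrow> 1" "\<And>n. 0 < \<mu> n" "\<And>n. \<mu> n < 1"
  shows "(\<lambda>n. 2 * w * (c (\<mu> n * w) - c w) * ((\<mu> n)\<^sup>2 / (1 - (\<mu> n)\<^sup>2))) \<longlonglongrightarrow> w * (c w - \<psi> w)"
proof -
  have "filterlim (\<lambda>n. \<mu> n * w) (at w) sequentially"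
    unfolding filterlim_at using \<mu> w
    by (auto intro!: tendsto_eq_intros intro: always_eventually simp: less_imp_neq)
  with c_deriv[OF w] have "(\<lambda>n. (c (\<mu> n * w) - c w) / (\<mu> n * w - w)) \<longlonglongrightarrow> (\<psi> w - c w) / w"
    unfolding has_field_derivative_iff by (rule filterlim_compose)
  then have "(\<lambda>n. (c (\<mu> n * w) - c w) / (\<mu> n * w - w) * (- 2 * w * w * (\<mu> n)\<^sup>2 / (1 + \<mu> n)))
      \<longlonglongrightarrow> (\<psi> w - c w) / w * (- 2 * w * w * 1\<^sup>2 / (1 + 1))"
    by (rule tendsto_mult) (auto intro!: tendsto_eq_intros \<mu>)
  moreover have "(c (\<mu> n * w) - c w) / (\<mu> n * w - w) * (- 2 * w * w * (\<mu> n)\<^sup>2 / (1 + \<mu> n))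
      = 2 * w * (c (\<mu> n * w) - c w) * ((\<mu> n)\<^sup>2 / (1 - (\<mu> n)\<^sup>2))" for n
  proof -
    have "\<mu> n * w - w = - (1 - \<mu> n) * w" "1 - (\<mu> n)\<^sup>2 = (1 - \<mu> n) * (1 + \<mu> n)"
      by (auto simp: algebra_simps power2_eq_square)
    moreover have "1 - \<mu> n \<noteq> 0" "1 + \<mu> n \<noteq> 0" using \<mu>(2,3)[of n] by auto
    moreover have "a / (- x * w) * (- 2 * w * w * z / y) = 2 * w * a * (z / (x * y))"
      if "x \<noteq> 0" "y \<noteq> 0" for a x y z :: real
      using that w by (simp add: field_simps)
    ultimately show ?thesis by metis
  qed
  moreover have "(\<psi> w - c w) / w * (- 2 * w * w * 1\<^sup>2 / (1 + 1)) = w * (c w - \<psi> w)"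
    using w by (simp add: field_simps)
  ultimately show ?thesis by simp
qed

end

section \<open>Two-good mechanisms in quantile coordinates\<close>

locale two_good_mechanism =
  good1: regular_quantile c1 \<psi>1 r1 + good2: regular_quantile c2 \<psi>2 r2
  for c1 \<psi>1 r1 c2 \<psi>2 r2 +
  fixes q1 q2 s :: "real \<Rightarrow> real \<Rightarrow> real"
  assumes q1_measurable [measurable]: "case_prod q1 \<in> borel_measurable (unif \<Otimes>\<^sub>M unif)"
    and q2_measurable [measurable]: "case_prod q2 \<in> borel_measurable (unif \<Otimes>\<^sub>M unif)"
    and s_integrable: "integrable (unif \<Otimes>\<^sub>M unif) (case_prod s)"
    and q1_bounds: "\<lbrakk>u \<in> {0<..<1}; v \<in> {0<..<1}\<rbrakk> \<Longrightarrow> 0 \<le> q1 u v \<and> q1 u v \<le> 1"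
    and q2_bounds: "\<lbrakk>u \<in> {0<..<1}; v \<in> {0<..<1}\<rbrakk> \<Longrightarrow> 0 \<le> q2 u v \<and> q2 u v \<le> 1"
    and individually_rational:
      "\<lbrakk>u \<in> {0<..<1}; v \<in> {0<..<1}\<rbrakk> \<Longrightarrow> 0 \<le> q1 u v * c1 u + q2 u v * c2 v - s u v"
    and incentive_compatible:
      "\<lbrakk>u \<in> {0<..<1}; v \<in> {0<..<1}; u' \<in> {0<..<1}; v' \<in> {0<..<1}\<rbrakk>
        \<Longrightarrow> q1 u' v' * c1 u + q2 u' v' * c2 v - s u' v' \<le> q1 u v * c1 u + q2 u v * c2 v - s u v"
begin

lemma s_measurable [measurable]: "case_prod s \<in> borel_measurable (unif \<Otimes>\<^sub>M unif)"
  using s_integrable by (rule borel_measurable_integrable)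

text \<open>The buyer's payoff at equal quantiles of the two goods, that is, for the lowest type of
  a slice in either half of the square.\<close>

definition B :: "real \<Rightarrow> real" where
  "B v = q1 v v * c1 v + q2 v v * c2 v - s v v"

lemma diagonal_measurable:
  assumes "case_prod f \<in> borel_measurable (unif \<Otimes>\<^sub>M unif)"
  shows "(\<lambda>v. f v v :: real) \<in> borel_measurable unif"
proof -
  have "(\<lambda>v. case_prod f (v, v)) \<in> borel_measurable unif"
    by (rule measurable_compose[OF _ assms]) simp
  then show ?thesis by simp
qed

lemmas [measurable] = diagonal_measurable[OF q1_measurable] diagonal_measurable[OF q2_measurable]
  diagonal_measurable[OF s_measurable]

lemma B_measurable [measurable]: "B \<in> borel_measurable unif"
  unfolding B_def [abs_def] by measurable

lemma B_nonneg: "v \<in> {0<..<1} \<Longrightarrow> 0 \<le> B v"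
  unfolding B_def by (rule individually_rational)

lemma B_ge: "\<lbrakk>v \<in> {0<..<1}; w \<in> {0<..<1}\<rbrakk>
    \<Longrightarrow> B w + q1 w w * (c1 v - c1 w) + q2 w w * (c2 v - c2 w) \<le> B v"
  unfolding B_def using incentive_compatible[of v v w w] by (simp add: algebra_simps)

text \<open>The type at quantile 1/2 could imitate the one at \<open>v\<close>, which caps
  \<open>B v\<close> by \<open>B (1/2) + c1 v + c2 v\<close>; the factor \<open>v\<close> turns the
  unbounded part into revenues.\<close>

lemma integrable_B: "integrable unif (\<lambda>v. v * B v)"
proof (rule unif.integrable_const_bound[where B = "B (1/2) + r1 + r2"])
  show "AE v in unif. norm (v * B v) \<le> B (1/2) + r1 + r2"
  proof (rule AE_I2)
    fix v assume "v \<in> space unif"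
    then have v: "v \<in> {0<..<1}" "0 < v" "v < 1" by auto
    have h: "(1/2 :: real) \<in> {0<..<1}" by simp
    have "q1 v v * c1 v \<le> c1 v" "q2 v v * c2 v \<le> c2 v" "0 \<le> q1 v v * c1 (1/2)" "0 \<le> q2 v v * c2 (1/2)"
      using q1_bounds[OF v(1) v(1)] q2_bounds[OF v(1) v(1)] good1.c_nonneg[OF v(2,3)]
        good2.c_nonneg[OF v(2,3)] good1.c_nonneg[of "1/2"] good2.c_nonneg[of "1/2"]
      by (auto simp: mult_left_le_one_le)
    with B_ge[OF h v(1)] have "B v \<le> B (1/2) + c1 v + c2 v"
      by (simp add: algebra_simps)
    then have "v * B v \<le> v * (B (1/2) + c1 v + c2 v)"
      using v by (intro mult_left_mono) auto
    also have "\<dots> = v * B (1/2) + v * c1 v + v * c2 v" by (simp add: algebra_simps)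
    also have "\<dots> \<le> B (1/2) + r1 + r2"
      using good1.revenue_le[OF v(2,3)] good2.revenue_le[OF v(2,3)] B_nonneg[OF h] v
      by (intro add_mono) (auto simp: mult_left_le_one_le)
    finally show "norm (v * B v) \<le> B (1/2) + r1 + r2"
      using B_nonneg[OF v(1)] v by simp
  qed
qed measurable

lemma q1_anti: "q1 u' v \<le> q1 u v" if "0 < u" "u \<le> u'" "u' < 1" "v \<in> {0<..<1}"
proof (cases "u = u'")
  case False
  then have "c1 u' < c1 u" using that by (intro good1.c_strict_anti) auto
  moreover have "0 \<le> (q1 u v - q1 u' v) * (c1 u - c1 u')"
    using incentive_compatible[of u v u' v] incentive_compatible[of u' v u v] that
    by (auto simp: algebra_simps)
  ultimately show ?thesis by (simp add: zero_le_mult_iff)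
qed simp

lemma q2_anti: "q2 u v' \<le> q2 u v" if "0 < v" "v \<le> v'" "v' < 1" "u \<in> {0<..<1}"
proof (cases "v = v'")
  case False
  then have "c2 v' < c2 v" using that by (intro good2.c_strict_anti) auto
  moreover have "0 \<le> (q2 u v - q2 u v') * (c2 v - c2 v')"
    using incentive_compatible[of u v u v'] incentive_compatible[of u v' u v] that
    by (auto simp: algebra_simps)
  ultimately show ?thesis by (simp add: zero_le_mult_iff)
qed simp

lemma integrable_triangle_times:
  assumes f [measurable]: "case_prod f \<in> borel_measurable (unif \<Otimes>\<^sub>M unif)"
    and bounds: "\<And>u v. \<lbrakk>u \<in> {0<..<1}; v \<in> {0<..<1}\<rbrakk> \<Longrightarrow> 0 \<le> f u v \<and> f u v \<le> 1"
  shows "integrable (unif \<Otimes>\<^sub>M unif) (\<lambda>(u, v). indicator {u<..} v * (f u v * c2 v))"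
proof (rule Bochner_Integration.integrable_bound[OF good2.integrable_triangle])
  have "(\<lambda>(u, v). indicator {u<..} v * (f u v * c2 v))
      = (\<lambda>p. if fst p < snd p then case_prod f p * c2 (snd p) else 0)"
    by (auto simp: fun_eq_iff)
  then show "(\<lambda>(u, v). indicator {u<..} v * (f u v * c2 v)) \<in> borel_measurable (unif \<Otimes>\<^sub>M unif)"
    by simp
  show "AE p in unif \<Otimes>\<^sub>M unif. norm (case p of (u, v) \<Rightarrow> indicator {u<..} v * (f u v * c2 v))
      \<le> norm (case p of (u, v) \<Rightarrow> indicator {u<..} v * c2 v)"
  proof (rule AE_I2)
    fix p assume "p \<in> space (unif \<Otimes>\<^sub>M unif)"
    then obtain u v where p: "p = (u, v)" "u \<in> {0<..<1}" "v \<in> {0<..<1}"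
      by (auto simp: space_pair_measure)
    then show "norm (case p of (u, v) \<Rightarrow> indicator {u<..} v * (f u v * c2 v))
        \<le> norm (case p of (u, v) \<Rightarrow> indicator {u<..} v * c2 v)"
      using bounds[OF p(2,3)] good2.c_nonneg[of v]
      by (auto split: split_indicator simp: abs_mult mult_left_le_one_le)
  qed
qed

lemma integrable_triangle_s: "integrable (unif \<Otimes>\<^sub>M unif) (\<lambda>(u, v). indicator {u<..} v * s u v)"
proof (rule Bochner_Integration.integrable_bound[OF s_integrable])
  have "(\<lambda>(u, v). indicator {u<..} v * s u v)
      = (\<lambda>p. if fst p < snd p then case_prod s p else 0)"
    by (auto simp: fun_eq_iff)
  then show "(\<lambda>(u, v). indicator {u<..} v * s u v) \<in> borel_measurable (unif \<Otimes>\<^sub>M unif)"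
    by simp
qed (auto split: split_indicator)

section \<open>Payments on one half of the square\<close>

text \<open>For fixed \<open>v\<close>, charging \<open>s u v - q2 u v * c2 v\<close> for good 1 alone is a single-good mechanism.\<close>

lemma section_payment_le:
  assumes v: "v \<in> {0<..<1}"
    and int: "integrable unif (\<lambda>u. indicator {u<..} v * (s u v - q2 u v * c2 v))"
  shows "(\<integral>u. indicator {u<..} v * (s u v - q2 u v * c2 v) \<partial>unif)
    \<le> - v * B v + q1 v v * (v * c1 v) + (1 - q1 v v) * r1"
proof -
  define S where "S u = s u v - q2 u v * c2 v" for u
  have ind: "indicator {u<..} v = (indicator {0<..<v} u :: real)" if "u \<in> space unif" for u
    using that by (auto split: split_indicator)
  have sub: "{0<..<v} \<subseteq> {0<..<1}" using v by auto
  have "integrable unif (\<lambda>u. indicator {0<..<v} u * S u)"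
    using int by (rule iffD1[OF Bochner_Integration.integrable_cong, rotated 2]) (auto simp: S_def ind)
  then have int': "set_integrable lborel {0<..<v} S"
    by (simp add: unif_set_integrable[OF sub])
  have null: "AE u in lborel. indicator {0<..<v} u *\<^sub>R S u = indicator {0<..v} u *\<^sub>R S u"
    using AE_lborel_singleton[of v] by eventually_elim (auto split: split_indicator)
  have int'': "set_integrable lborel {0<..v} S"
  proof -
    have "set_integrable lborel ({0<..<v} \<union> {v}) S"
    proof (rule set_integrable_Un[OF int'])
      have "(\<lambda>u. indicator {v} u *\<^sub>R S u) = (\<lambda>u. indicator {v} u *\<^sub>R S v)"
        by (auto split: split_indicator)
      then show "set_integrable lborel {v} S" by (simp add: set_integrable_def)
    qed auto
    moreover have "{0<..<v} \<union> {v} = {0<..v}" using v by auto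
    ultimately show ?thesis by simp
  qed
  have "(\<integral>u. indicator {u<..} v * (s u v - q2 u v * c2 v) \<partial>unif) = (\<integral>u. indicator {0<..<v} u * S u \<partial>unif)"
    by (intro Bochner_Integration.integral_cong) (auto simp: S_def ind)
  also have "\<dots> = (LINT u:{0<..<v}|lborel. S u)" by (rule unif_set_integral[OF sub])
  also have "\<dots> = (LINT u:{0<..v}|lborel. S u)"
    unfolding set_lebesgue_integral_def
    using int' int'' null by (intro integral_cong_AE) (auto simp: set_integrable_def)
  also have "\<dots> \<le> v * S v + r1 * (1 - q1 v v)"
  proof (rule antitone_payment_bound[where Q = "\<lambda>u. q1 u v" and c = c1, OF _ _ _ _ _ _ good1.r_nonneg int''])
    fix u w assume uw: "0 < u" "u \<le> w" "w \<le> v"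
    then have I: "u \<in> {0<..<1}" "w \<in> {0<..<1}" using v by auto
    show "S u \<le> S w + (q1 u v - q1 w v) * c1 u"
      using incentive_compatible[of u v w v] I v by (simp add: S_def algebra_simps)
    show "q1 w v \<le> q1 u v" using q1_anti[of u w v] uw v by auto
    then have "0 \<le> (q1 u v - q1 w v) * c1 w"
      using good1.c_nonneg[of w] I by auto
    then show "S w \<le> S u"
      using incentive_compatible[of w v u v] I v by (simp add: S_def algebra_simps)
  qed (use v q1_bounds good1.revenue_le in auto)
  \<comment> \<open>Here the diagonal payoff enters: \<open>S v\<close> equals
    \<open>q1 v v * c1 v - B v\<close>.\<close>
  finally show ?thesis by (simp add: S_def B_def algebra_simps)
qed

text \<open>The two parts of the payment are integrated in opposite orders: the charge for good 1
  over \<open>u\<close> with \<open>v\<close> fixed, and \<open>q2 u v * c2 v\<close> over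
  \<open>v\<close> with \<open>u\<close> fixed, where \<open>q2 u v \<le> q2 u u\<close> because
  \<open>u < v\<close>. Both allocations thus end up on the diagonal.\<close>

lemma half_square_le:
  "(\<integral>p. (case p of (u, v) \<Rightarrow> indicator {u<..} v * s u v) \<partial>(unif \<Otimes>\<^sub>M unif))
    \<le> (\<integral>v. - v * B v + q1 v v * (v * c1 v) + (1 - q1 v v) * r1 \<partial>unif)
      + (\<integral>u. q2 u u * good2.K u \<partial>unif)"
proof -
  let ?S = "\<lambda>u v. indicator {u<..} v * (s u v - q2 u v * c2 v)"
  let ?T = "\<lambda>u v. indicator {u<..} v * (q2 u v * c2 v)"
  let ?T' = "\<lambda>u v. indicator {u<..} v * (q2 u u * c2 v)"
  have T: "integrable (unif \<Otimes>\<^sub>M unif) (case_prod ?T)"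
    by (rule integrable_triangle_times) (use q2_bounds in auto)
  have T': "integrable (unif \<Otimes>\<^sub>M unif) (case_prod ?T')"
    by (rule integrable_triangle_times[where f = "\<lambda>u v. q2 u u"]) (use q2_bounds in auto)
  have "integrable (unif \<Otimes>\<^sub>M unif) (\<lambda>p. (case p of (u, v) \<Rightarrow> indicator {u<..} v * s u v) - case_prod ?T p)"
    by (rule Bochner_Integration.integrable_diff[OF integrable_triangle_s T])
  moreover have "(\<lambda>p. (case p of (u, v) \<Rightarrow> indicator {u<..} v * s u v) - case_prod ?T p) = case_prod ?S"
    by (auto simp: fun_eq_iff algebra_simps)
  ultimately have S: "integrable (unif \<Otimes>\<^sub>M unif) (case_prod ?S)" by simp
  have "(\<integral>p. (case p of (u, v) \<Rightarrow> indicator {u<..} v * s u v) \<partial>(unif \<Otimes>\<^sub>M unif))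
      = (\<integral>p. case_prod ?S p + case_prod ?T p \<partial>(unif \<Otimes>\<^sub>M unif))"
    by (intro Bochner_Integration.integral_cong) (auto simp: algebra_simps)
  also have "\<dots> = (\<integral>p. case_prod ?S p \<partial>(unif \<Otimes>\<^sub>M unif)) + (\<integral>p. case_prod ?T p \<partial>(unif \<Otimes>\<^sub>M unif))"
    by (rule Bochner_Integration.integral_add[OF S T])
  finally have split: "(\<integral>p. (case p of (u, v) \<Rightarrow> indicator {u<..} v * s u v) \<partial>(unif \<Otimes>\<^sub>M unif)) = \<dots>" .
  have "(\<integral>p. case_prod ?S p \<partial>(unif \<Otimes>\<^sub>M unif)) = (\<integral>v. \<integral>u. ?S u v \<partial>unif \<partial>unif)"
    by (rule unif2.integral_snd[OF S, symmetric])
  also have "\<dots> \<le> (\<integral>v. - v * B v + q1 v v * (v * c1 v) + (1 - q1 v v) * r1 \<partial>unif)"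
  proof (rule integral_mono_AE)
    show "integrable unif (\<lambda>v. \<integral>u. ?S u v \<partial>unif)" by (rule unif2.integrable_snd[OF S])
    have "integrable unif (\<lambda>v. q1 v v * (v * c1 v))" "integrable unif (\<lambda>v. (1 - q1 v v) * r1)"
      by (rule integrable_unif_bounded_times; use q1_bounds good1.integrable_revenue in simp)+
    then show "integrable unif (\<lambda>v. - v * B v + q1 v v * (v * c1 v) + (1 - q1 v v) * r1)"
      using integrable_B by auto
    show "AE v in unif. (\<integral>u. ?S u v \<partial>unif) \<le> - v * B v + q1 v v * (v * c1 v) + (1 - q1 v v) * r1"
      using unif2.AE_integrable_snd[OF S] AE_space
      by eventually_elim (rule section_payment_le, auto)
  qed
  finally have S_le: "(\<integral>p. case_prod ?S p \<partial>(unif \<Otimes>\<^sub>M unif)) \<le> \<dots>" .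
  have "(\<integral>p. case_prod ?T p \<partial>(unif \<Otimes>\<^sub>M unif)) \<le> (\<integral>p. case_prod ?T' p \<partial>(unif \<Otimes>\<^sub>M unif))"
  proof (rule integral_mono[OF T T'])
    fix p assume "p \<in> space (unif \<Otimes>\<^sub>M unif)"
    then obtain u v where p: "p = (u, v)" "u \<in> {0<..<1}" "v \<in> {0<..<1}"
      by (auto simp: space_pair_measure)
    then show "case_prod ?T p \<le> case_prod ?T' p"
      using q2_anti[of u v u] good2.c_nonneg[of v]
      by (auto split: split_indicator intro!: mult_right_mono)
  qed
  also have "\<dots> = (\<integral>u. \<integral>v. ?T' u v \<partial>unif \<partial>unif)"
    by (rule unif2.integral_fst[OF T', symmetric])
  also have "\<dots> = (\<integral>u. q2 u u * good2.K u \<partial>unif)"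
  proof (rule Bochner_Integration.integral_cong[OF refl])
    fix u
    have "(\<lambda>v. indicator {u<..} v * (q2 u u * c2 v)) = (\<lambda>v. q2 u u * (indicator {u<..} v * c2 v))"
      by auto
    then show "(\<integral>v. ?T' u v \<partial>unif) = q2 u u * good2.K u"
      by (simp only: good2.K_def integral_mult_right_zero)
  qed
  finally have "(\<integral>p. case_prod ?T p \<partial>(unif \<Otimes>\<^sub>M unif)) \<le> (\<integral>u. q2 u u * good2.K u \<partial>unif)" .
  with S_le show ?thesis unfolding split by (rule add_mono)
qed

text \<open>A lower bound for \<open>B (\<mu> * w) - B w\<close> by \<open>B_ge\<close>: the type at
  \<open>\<mu> * w\<close> can imitate the type at \<open>w\<close>.\<close>

definition gain :: "real \<Rightarrow> real \<Rightarrow> real" where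
  "gain \<mu> w = q1 w w * (c1 (\<mu> * w) - c1 w) + q2 w w * (c2 (\<mu> * w) - c2 w)"

text \<open>Compares the integral of \<open>w * B w\<close> with its image under \<open>w \<mapsto> \<mu> w\<close>; letting \<open>\<mu> \<longrightarrow> 1\<close> with Fatou's lemma
  then plays the role of differentiating \<open>B\<close>.\<close>

lemma scaled_diagonal_bound:
  assumes \<mu>: "0 < \<mu>" "\<mu> < 1"
  shows "(\<integral>\<^sup>+w. ennreal (2 * w * gain \<mu> w * (\<mu>\<^sup>2 / (1 - \<mu>\<^sup>2))) \<partial>unif) \<le> (\<integral>\<^sup>+w. ennreal (2 * w * B w) \<partial>unif)"
proof -
  have \<mu>2: "0 < \<mu>\<^sup>2" "\<mu>\<^sup>2 < 1" using \<mu> by (auto simp: power_less_one_iff)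
  have gain_nonneg: "0 \<le> gain \<mu> w" if w: "w \<in> {0<..<1}" for w
  proof -
    have "\<mu> * w \<le> w" "0 < \<mu> * w" using \<mu> w by auto
    then have "c1 w \<le> c1 (\<mu> * w)" "c2 w \<le> c2 (\<mu> * w)"
      using w by (auto intro: good1.c_anti good2.c_anti)
    then show ?thesis using q1_bounds[OF w w] q2_bounds[OF w w] by (simp add: gain_def)
  qed
  have scale_in: "\<mu> * w \<in> {0<..<1}" if "w \<in> {0<..<1}" for w
    using \<mu> that mult_strict_mono[of \<mu> 1 w 1] by auto
  have scaled [measurable]: "(\<lambda>w. f (\<mu> * w)) \<in> borel_measurable unif"
    if "f \<in> borel_measurable unif" for f :: "real \<Rightarrow> real"
  proof (rule measurable_compose[OF _ that])
    show "(\<lambda>w. \<mu> * w) \<in> unif \<rightarrow>\<^sub>M unif"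
      by (rule measurable_restrict_space2) (use scale_in in auto)
  qed
  have gain_meas [measurable]: "gain \<mu> \<in> borel_measurable unif"
    unfolding gain_def [abs_def] by measurable
  define i where "i = (\<integral>w. 2 * w * B w \<partial>unif)"
  have I: "(\<integral>\<^sup>+w. ennreal (2 * w * B w) \<partial>unif) = ennreal i"
    unfolding i_def using integrable_B B_nonneg
    by (intro nn_integral_eq_integral) (auto simp: mult.assoc)
  have i: "0 \<le> i"
    unfolding i_def using B_nonneg by (intro Bochner_Integration.integral_nonneg) auto
  define G where "G = (\<integral>\<^sup>+w. ennreal (2 * w * gain \<mu> w) \<partial>unif)"
  have "ennreal i + G = (\<integral>\<^sup>+w. ennreal (2 * w * B w) + ennreal (2 * w * gain \<mu> w) \<partial>unif)"
    unfolding I[symmetric] G_def by (subst nn_integral_add) auto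
  also have "\<dots> = (\<integral>\<^sup>+w. ennreal (2 * w * (B w + gain \<mu> w)) \<partial>unif)"
    using gain_nonneg B_nonneg
    by (intro nn_integral_cong) (simp add: ennreal_plus[symmetric] distrib_left del: ennreal_plus)
  also have "\<dots> \<le> (\<integral>\<^sup>+w. ennreal (1 / \<mu>) * ennreal (2 * (\<mu> * w) * B (\<mu> * w)) \<partial>unif)"
  proof (rule nn_integral_mono)
    fix w assume "w \<in> space unif"
    then have w: "w \<in> {0<..<1}" by simp
    have "B w + gain \<mu> w \<le> B (\<mu> * w)"
      using B_ge[OF scale_in[OF w] w] by (simp add: gain_def)
    then have "2 * w * (B w + gain \<mu> w) \<le> 2 * w * B (\<mu> * w)"
      using w by (intro mult_left_mono) auto
    then show "ennreal (2 * w * (B w + gain \<mu> w)) \<le> ennreal (1 / \<mu>) * ennreal (2 * (\<mu> * w) * B (\<mu> * w))"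
      using \<mu> w by (simp add: ennreal_mult'[symmetric] ennreal_leI)
  qed
  also have "\<dots> = ennreal (1 / \<mu>) * (\<integral>\<^sup>+w. ennreal (2 * (\<mu> * w) * B (\<mu> * w)) \<partial>unif)"
    by (rule nn_integral_cmult) measurable
  \<comment> \<open>Two factors \<open>\<mu>\<close> are spent: one cancels the
    \<open>1 / \<mu>\<close> from writing \<open>w\<close> as \<open>(\<mu> * w) / \<mu>\<close>,
    the other is the Jacobian of the scaling.\<close>
  finally have "ennreal \<mu> * (ennreal \<mu> * (ennreal i + G))
      \<le> ennreal \<mu> * (ennreal \<mu> * (ennreal (1 / \<mu>) * (\<integral>\<^sup>+w. ennreal (2 * (\<mu> * w) * B (\<mu> * w)) \<partial>unif)))"
    by (intro mult_left_mono) auto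
  also have "\<dots> = ennreal \<mu> * (\<integral>\<^sup>+w. ennreal (2 * (\<mu> * w) * B (\<mu> * w)) \<partial>unif)"
    using \<mu> by (simp add: mult.assoc[symmetric] ennreal_mult'[symmetric])
  also have "\<dots> \<le> ennreal i"
    unfolding I[symmetric] by (rule nn_integral_unif_scale_le[OF _ \<mu>]) measurable
  finally have le: "ennreal (\<mu>\<^sup>2) * (ennreal i + G) \<le> ennreal i"
    using \<mu> by (simp add: power2_eq_square ennreal_mult mult.assoc)
  \<comment> \<open>The inequality just obtained has a finite right side, so it forces
    \<open>G\<close> to be finite; only then can it be rearranged over the reals.\<close>
  have "G \<noteq> \<infinity>"
  proof
    assume "G = \<infinity>"
    then show False using le \<mu>2 by (simp add: ennreal_mult_top top_unique)
  qed
  then obtain g where g: "G = ennreal g" "0 \<le> g" by (cases G) auto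
  have "\<mu>\<^sup>2 * (i + g) \<le> i"
    using le g i \<mu>2 by (simp add: ennreal_mult'[symmetric] ennreal_plus[symmetric] ennreal_le_iff del: ennreal_plus)
  then have "g * (\<mu>\<^sup>2 / (1 - \<mu>\<^sup>2)) \<le> i"
    using \<mu>2 by (simp add: field_simps)
  moreover have "(\<integral>\<^sup>+w. ennreal (2 * w * gain \<mu> w * (\<mu>\<^sup>2 / (1 - \<mu>\<^sup>2))) \<partial>unif)
      = (\<integral>\<^sup>+w. ennreal (\<mu>\<^sup>2 / (1 - \<mu>\<^sup>2)) * ennreal (2 * w * gain \<mu> w) \<partial>unif)"
    using \<mu>2 by (intro nn_integral_cong) (subst ennreal_mult'[symmetric], auto simp: ac_simps)
  moreover have "\<dots> = ennreal (\<mu>\<^sup>2 / (1 - \<mu>\<^sup>2)) * G"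
    unfolding G_def by (rule nn_integral_cmult) measurable
  ultimately show ?thesis
    unfolding I g(1) using \<mu>2 g(2) by (simp add: ennreal_mult'[symmetric] mult.commute ennreal_leI)
qed

text \<open>Fatou gives one direction only, the useful one, since \<open>B\<close> enters the
  revenue with a negative sign. Stated for nonnegative integrals, it also yields the integrability
  of its left side.\<close>

lemma diagonal_payoff_bound:
  "(\<integral>\<^sup>+w. ennreal (q1 w w * (w * (c1 w - \<psi>1 w)) + q2 w w * (w * (c2 w - \<psi>2 w))) \<partial>unif)
    \<le> (\<integral>\<^sup>+w. ennreal (2 * w * B w) \<partial>unif)"
proof -
  define \<mu> where "\<mu> n = (real n + 1) / (real n + 2)" for n
  have \<mu>: "\<mu> \<longlonglongrightarrow> 1" "0 < \<mu> n" "\<mu> n < 1" for n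
    unfolding \<mu>_def by (real_asymp, auto simp: field_simps)
  let ?h = "\<lambda>n w. ennreal (2 * w * gain (\<mu> n) w * ((\<mu> n)\<^sup>2 / (1 - (\<mu> n)\<^sup>2)))"
  have scaled [measurable]: "(\<lambda>w. f (\<mu> n * w)) \<in> borel_measurable unif"
    if "f \<in> borel_measurable unif" for f :: "real \<Rightarrow> real" and n
  proof (rule measurable_compose[OF _ that])
    show "(\<lambda>w. \<mu> n * w) \<in> unif \<rightarrow>\<^sub>M unif"
    proof (rule measurable_restrict_space2)
      show "(\<lambda>w. \<mu> n * w) \<in> space unif \<rightarrow> {0<..<1}"
        using \<mu>(2,3)[of n] mult_strict_mono[of "\<mu> n" 1 _ 1] by auto
    qed simp
  qed
  have "(\<integral>\<^sup>+w. ennreal (q1 w w * (w * (c1 w - \<psi>1 w)) + q2 w w * (w * (c2 w - \<psi>2 w))) \<partial>unif)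
      = (\<integral>\<^sup>+w. liminf (\<lambda>n. ?h n w) \<partial>unif)"
  proof (rule nn_integral_cong)
    fix w assume "w \<in> space unif"
    then have w: "0 < w" "w < 1" by auto
    have "(\<lambda>n. q1 w w * (2 * w * (c1 (\<mu> n * w) - c1 w) * ((\<mu> n)\<^sup>2 / (1 - (\<mu> n)\<^sup>2)))
          + q2 w w * (2 * w * (c2 (\<mu> n * w) - c2 w) * ((\<mu> n)\<^sup>2 / (1 - (\<mu> n)\<^sup>2))))
        \<longlonglongrightarrow> q1 w w * (w * (c1 w - \<psi>1 w)) + q2 w w * (w * (c2 w - \<psi>2 w))"
      by (intro tendsto_intros good1.tendsto_scaled_difference good2.tendsto_scaled_difference w \<mu>)
    then have "(\<lambda>n. 2 * w * gain (\<mu> n) w * ((\<mu> n)\<^sup>2 / (1 - (\<mu> n)\<^sup>2)))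
        \<longlonglongrightarrow> q1 w w * (w * (c1 w - \<psi>1 w)) + q2 w w * (w * (c2 w - \<psi>2 w))"
      by (simp add: gain_def algebra_simps)
    then have "(\<lambda>n. ?h n w) \<longlonglongrightarrow> ennreal (q1 w w * (w * (c1 w - \<psi>1 w)) + q2 w w * (w * (c2 w - \<psi>2 w)))"
      by (rule tendsto_ennrealI)
    then show "ennreal (q1 w w * (w * (c1 w - \<psi>1 w)) + q2 w w * (w * (c2 w - \<psi>2 w))) = liminf (\<lambda>n. ?h n w)"
      by (intro lim_imp_Liminf[symmetric]) auto
  qed
  also have "\<dots> \<le> liminf (\<lambda>n. \<integral>\<^sup>+w. ?h n w \<partial>unif)"
    by (rule nn_integral_liminf) (unfold gain_def, measurable)
  also have "\<dots> \<le> (\<integral>\<^sup>+w. ennreal (2 * w * B w) \<partial>unif)"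
    by (intro Liminf_le always_eventually allI scaled_diagonal_bound \<mu>) auto
  finally show ?thesis .
qed

section \<open>Combining the two halves by symmetry\<close>

lemma swap: "two_good_mechanism c2 \<psi>2 r2 c1 \<psi>1 r1 (\<lambda>u v. q2 v u) (\<lambda>u v. q1 v u) (\<lambda>u v. s v u)"
proof unfold_locales
  show "(\<lambda>(u, v). q2 v u) \<in> borel_measurable (unif \<Otimes>\<^sub>M unif)"
    "(\<lambda>(u, v). q1 v u) \<in> borel_measurable (unif \<Otimes>\<^sub>M unif)"
    using measurable_compose[OF measurable_pair_swap' q1_measurable]
      measurable_compose[OF measurable_pair_swap' q2_measurable] by (simp_all add: split_beta')
  show "integrable (unif \<Otimes>\<^sub>M unif) (\<lambda>(u, v). s v u)"
    using unif2.integrable_product_swap[OF s_integrable] by simp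
  fix u v u' v' :: real assume I: "u \<in> {0<..<1}" "v \<in> {0<..<1}"
  show "0 \<le> q2 v u * c2 u + q1 v u * c1 v - s v u"
    using individually_rational[OF I(2,1)] by simp
  assume I': "u' \<in> {0<..<1}" "v' \<in> {0<..<1}"
  show "q2 v' u' * c2 u + q1 v' u' * c1 v - s v' u' \<le> q2 v u * c2 u + q1 v u * c1 v - s v u"
    using incentive_compatible[OF I(2,1) I'(2,1)] by simp
qed (use q1_bounds q2_bounds in auto)

lemma AE_off_diagonal: "AE p in unif \<Otimes>\<^sub>M unif. fst p \<noteq> snd p"
proof (rule unif2.AE_pair_measure)
  show "AE x in unif. AE y in unif. fst (x, y) \<noteq> snd (x, y)"
  proof (rule AE_I2)
    fix x :: real
    show "AE y in unif. fst (x, y) \<noteq> snd (x, y)"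
      using AE_lborel_singleton[of x] by (auto simp: AE_restrict_space_iff)
  qed
qed measurable

lemma revenue_bound:
  "(\<integral>p. case_prod s p \<partial>(unif \<Otimes>\<^sub>M unif)) \<le> (1 + 1 / exp 1) * (r1 + r2)"
proof -
  interpret swap: two_good_mechanism c2 \<psi>2 r2 c1 \<psi>1 r1 "\<lambda>u v. q2 v u" "\<lambda>u v. q1 v u" "\<lambda>u v. s v u"
    by (rule swap)
  have swap_B: "swap.B = B" by (auto simp: fun_eq_iff swap.B_def B_def)
  let ?upper = "\<lambda>p. case p of (u, v) \<Rightarrow> indicator {u<..} v * s u v"
  let ?lower = "\<lambda>p. case p of (u, v) \<Rightarrow> indicator {v<..} u * s u v"
  have lower_int: "integrable (unif \<Otimes>\<^sub>M unif) ?lower"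
    using unif2.integrable_product_swap[OF swap.integrable_triangle_s] by simp
  have lower_eq: "(\<integral>p. ?lower p \<partial>(unif \<Otimes>\<^sub>M unif))
      = (\<integral>p. (case p of (u, v) \<Rightarrow> indicator {u<..} v * s v u) \<partial>(unif \<Otimes>\<^sub>M unif))"
    using unif2.integral_product_swap[OF borel_measurable_integrable[OF lower_int]] by simp
  have "(\<integral>p. case_prod s p \<partial>(unif \<Otimes>\<^sub>M unif)) = (\<integral>p. ?upper p + ?lower p \<partial>(unif \<Otimes>\<^sub>M unif))"
  proof (rule integral_cong_AE)
    show "(\<lambda>p. ?upper p + ?lower p) \<in> borel_measurable (unif \<Otimes>\<^sub>M unif)"
      using integrable_triangle_s lower_int by (intro borel_measurable_add) auto
    show "AE p in unif \<Otimes>\<^sub>M unif. case_prod s p = ?upper p + ?lower p"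
      using AE_off_diagonal by eventually_elim (auto split: split_indicator)
  qed measurable
  also have "\<dots> = (\<integral>p. ?upper p \<partial>(unif \<Otimes>\<^sub>M unif)) + (\<integral>p. ?lower p \<partial>(unif \<Otimes>\<^sub>M unif))"
    by (rule Bochner_Integration.integral_add[OF integrable_triangle_s lower_int])
  also have "\<dots> \<le> ((\<integral>v. - v * B v + q1 v v * (v * c1 v) + (1 - q1 v v) * r1 \<partial>unif)
      + (\<integral>u. q2 u u * good2.K u \<partial>unif))
    + ((\<integral>v. - v * B v + q2 v v * (v * c2 v) + (1 - q2 v v) * r2 \<partial>unif)
      + (\<integral>u. q1 u u * good1.K u \<partial>unif))"
    using half_square_le swap.half_square_le unfolding lower_eq swap_B by (intro add_mono) auto
  finally have bound: "(\<integral>p. case_prod s p \<partial>(unif \<Otimes>\<^sub>M unif)) \<le> \<dots>" .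

  let ?L1 = "\<lambda>w. q1 w w * (w * (c1 w - \<psi>1 w))" and ?L2 = "\<lambda>w. q2 w w * (w * (c2 w - \<psi>2 w))"
  have L_nonneg: "0 \<le> ?L1 w" "0 \<le> ?L2 w" if w: "w \<in> {0<..<1}" for w
    using q1_bounds[OF w w] q2_bounds[OF w w] good1.\<psi>_le_c[of w] good2.\<psi>_le_c[of w] w by auto
  have B_int: "integrable unif (\<lambda>w. 2 * w * B w)"
    using integrable_B by (simp add: mult.assoc)
  have B_nn: "(\<integral>\<^sup>+w. ennreal (2 * w * B w) \<partial>unif) = ennreal (\<integral>w. 2 * w * B w \<partial>unif)"
    using B_nonneg by (intro nn_integral_eq_integral[OF B_int]) auto
  \<comment> \<open>No direct bound on \<open>\<psi>1\<close> or \<open>\<psi>2\<close> is at hand;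
    finiteness comes from comparison with the payoff integral.\<close>
  have L_int: "integrable unif (\<lambda>w. ?L1 w + ?L2 w)"
  proof (rule integrableI_nonneg)
    show "(\<integral>\<^sup>+w. ennreal (?L1 w + ?L2 w) \<partial>unif) < \<infinity>"
      using diagonal_payoff_bound unfolding B_nn by (rule order.strict_trans1) simp
  qed (use L_nonneg in \<open>auto intro!: AE_I2 add_nonneg_nonneg\<close>)
  have L1_int: "integrable unif ?L1" and L2_int: "integrable unif ?L2"
    by (rule Bochner_Integration.integrable_bound[OF L_int];
        use L_nonneg in \<open>auto intro!: AE_I2\<close>)+
  have "ennreal (\<integral>w. ?L1 w + ?L2 w \<partial>unif) \<le> ennreal (\<integral>w. 2 * w * B w \<partial>unif)"
    using diagonal_payoff_bound L_nonneg unfolding B_nn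
    by (subst nn_integral_eq_integral[OF L_int, symmetric]) (auto intro!: AE_I2 add_nonneg_nonneg)
  then have "(\<integral>w. ?L1 w + ?L2 w \<partial>unif) \<le> (\<integral>w. 2 * w * B w \<partial>unif)"
    using B_nonneg by (subst (asm) ennreal_le_iff) (auto intro!: Bochner_Integration.integral_nonneg)
  then have L_le: "(\<integral>w. ?L1 w \<partial>unif) + (\<integral>w. ?L2 w \<partial>unif) \<le> 2 * (\<integral>w. w * B w \<partial>unif)"
    using L1_int L2_int by (simp add: mult.assoc)

  have ints: "integrable unif (\<lambda>v. q1 v v * (v * c1 v))" "integrable unif (\<lambda>v. (1 - q1 v v) * r1)"
    "integrable unif (\<lambda>v. q2 v v * (v * c2 v))" "integrable unif (\<lambda>v. (1 - q2 v v) * r2)"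
    "integrable unif (\<lambda>v. q1 v v * good1.K v)" "integrable unif (\<lambda>v. q2 v v * good2.K v)"
    by (rule integrable_unif_bounded_times;
        use q1_bounds q2_bounds good1.integrable_revenue good2.integrable_revenue
          good1.integrable_K good2.integrable_K in simp)+
  \<comment> \<open>\<open>- ?L1\<close> is the share of good 1 in what replaces the payoff terms.
    It turns the coefficient \<open>v * c1 v + good1.K v - r1\<close> of \<open>q1 v v\<close> into
    \<open>good1.D v\<close>.\<close>
  have D1: "(\<lambda>v. q1 v v * good1.D v) = (\<lambda>v. q1 v v * (v * c1 v) + (1 - q1 v v) * r1
      + q1 v v * good1.K v - ?L1 v - r1)"
    and D2: "(\<lambda>v. q2 v v * good2.D v) = (\<lambda>v. q2 v v * (v * c2 v) + (1 - q2 v v) * r2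
      + q2 v v * good2.K v - ?L2 v - r2)"
    by (auto simp: good1.D_def good2.D_def fun_eq_iff algebra_simps)
  have D1_int: "integrable unif (\<lambda>v. q1 v v * good1.D v)"
    and D2_int: "integrable unif (\<lambda>v. q2 v v * good2.D v)"
    unfolding D1 D2
    by (intro Bochner_Integration.integrable_diff Bochner_Integration.integrable_add ints L1_int L2_int unif.integrable_const)+
  have "(\<integral>v. q1 v v * good1.D v \<partial>unif) = (\<integral>v. q1 v v * (v * c1 v) \<partial>unif) + (\<integral>v. (1 - q1 v v) * r1 \<partial>unif)
      + (\<integral>v. q1 v v * good1.K v \<partial>unif) - (\<integral>v. ?L1 v \<partial>unif) - r1"
    unfolding D1
    by (subst Bochner_Integration.integral_diff Bochner_Integration.integral_add;
        (intro Bochner_Integration.integrable_diff Bochner_Integration.integrable_add ints L1_int unif.integrable_const)?)+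
      (use unif.prob_space in simp)
  moreover have "(\<integral>v. q2 v v * good2.D v \<partial>unif) = (\<integral>v. q2 v v * (v * c2 v) \<partial>unif) + (\<integral>v. (1 - q2 v v) * r2 \<partial>unif)
      + (\<integral>v. q2 v v * good2.K v \<partial>unif) - (\<integral>v. ?L2 v \<partial>unif) - r2"
    unfolding D2
    by (subst Bochner_Integration.integral_diff Bochner_Integration.integral_add;
        (intro Bochner_Integration.integrable_diff Bochner_Integration.integrable_add ints L2_int unif.integrable_const)?)+
      (use unif.prob_space in simp)
  moreover have "(\<integral>v. q1 v v * good1.D v \<partial>unif) \<le> r1 / exp 1"
    by (rule good1.integral_D_le[OF _ D1_int]) (use q1_bounds in auto)
  moreover have "(\<integral>v. q2 v v * good2.D v \<partial>unif) \<le> r2 / exp 1"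
    by (rule good2.integral_D_le[OF _ D2_int]) (use q2_bounds in auto)
  moreover have "(\<integral>v. - v * B v + q1 v v * (v * c1 v) + (1 - q1 v v) * r1 \<partial>unif)
      = - (\<integral>v. v * B v \<partial>unif) + (\<integral>v. q1 v v * (v * c1 v) \<partial>unif) + (\<integral>v. (1 - q1 v v) * r1 \<partial>unif)"
    "(\<integral>v. - v * B v + q2 v v * (v * c2 v) + (1 - q2 v v) * r2 \<partial>unif)
      = - (\<integral>v. v * B v \<partial>unif) + (\<integral>v. q2 v v * (v * c2 v) \<partial>unif) + (\<integral>v. (1 - q2 v v) * r2 \<partial>unif)"
    using integrable_B ints by simp_all
  ultimately have "(\<integral>p. case_prod s p \<partial>(unif \<Otimes>\<^sub>M unif)) \<le> r1 + r2 + (r1 / exp 1 + r2 / exp 1)"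
    using bound L_le by linarith
  then show ?thesis by (simp add: algebra_simps add_divide_distrib)
qed

end

section \<open>The quantile function of a weakly regular variable\<close>

lemma measure_eqI_atLeast:
  fixes M N :: "real measure"
  assumes "prob_space M" "sets M = sets borel" "sets N = sets borel"
    and eq: "\<And>t. emeasure M {t..} = emeasure N {t..}"
  shows "M = N"
proof (rule measure_eqI_generator_eq[where \<Omega> = UNIV and E = "range (\<lambda>t. {t..})" and A = "\<lambda>n. {- real n..}"])
  interpret M: prob_space M by fact
  have "{a..} \<inter> {b..} = {max a b..}" for a b :: real by auto
  then show "Int_stable (range (\<lambda>t::real. {t..}))"
    unfolding Int_stable_def by auto
  show "sets M = sigma_sets UNIV (range (\<lambda>t. {t..}))" "sets N = sigma_sets UNIV (range (\<lambda>t. {t..}))"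
    using assms by (simp_all add: borel_Ici)
  show "(\<Union>n. {- real n..}) = UNIV"
    by (auto simp: minus_le_iff intro: real_arch_simple)
  show "emeasure M {- real n..} \<noteq> \<infinity>" for n by simp
qed (use eq in auto)

text \<open>\<open>c\<close> inverts the tail probability \<open>G\<close> on the interior of the
  support, and \<open>\<psi>\<close> is the virtual valuation composed with \<open>c\<close>; as
  \<open>c\<close> decreases, a nondecreasing virtual valuation becomes a decreasing
  \<open>\<psi>\<close>.\<close>

lemma weakly_regular_quantile:
  assumes "prob_space M" and "weakly_regular M X"
  shows "\<exists>c \<psi> r. regular_quantile c \<psi> r \<and> distr unif borel c = distr M borel X"
proof -
  interpret prob_space M by fact
  obtain \<alpha> \<beta> f where \<alpha>: "0 \<le> \<alpha>" "ereal \<alpha> < \<beta>"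
    and dist: "distributed M lborel X (\<lambda>t. ennreal (indicator (support_interval \<alpha> \<beta>) t * f t))"
    and f_cont: "continuous_on (support_interval \<alpha> \<beta>) f"
    and f_pos: "\<And>t. t \<in> support_interval \<alpha> \<beta> \<Longrightarrow> 0 < f t"
    and \<phi>_mono: "mono_on (support_interval \<alpha> \<beta>) (\<lambda>t. t - prob {\<omega> \<in> space M. t \<le> X \<omega>} / f t)"
    using assms(2) unfolding weakly_regular_def by auto
  define I where "I = support_interval \<alpha> \<beta>"
  \<comment> \<open>The endpoints are dropped: \<open>G\<close> is 1 at the lower one and 0 at a
    finite upper one, so \<open>J\<close> is exactly what quantiles in the open unit interval
    reach.\<close>
  define J where "J = {t. \<alpha> < t \<and> ereal t < \<beta>}"
  define G where "G t = prob {\<omega> \<in> space M. t \<le> X \<omega>}" for t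
  have I_iff: "t \<in> I \<longleftrightarrow> \<alpha> \<le> t \<and> ereal t \<le> \<beta>" for t by (simp add: I_def support_interval_def)
  have I_interval: "{a..b} \<subseteq> I" if "\<alpha> \<le> a" "ereal b \<le> \<beta>" for a b
    using that by (auto simp: I_iff) (metis dual_order.trans ereal_less_eq(3))
  have J_I: "J \<subseteq> I" by (auto simp: J_def I_iff)
  have X_meas [measurable]: "X \<in> borel_measurable M"
    using distributed_measurable[OF dist] by simp
  have em: "emeasure M {\<omega> \<in> space M. X \<omega> \<in> A} = (\<integral>\<^sup>+t. ennreal (indicator I t * f t) * indicator A t \<partial>lborel)"
    if "A \<in> sets borel" for A
    using distributed_emeasure[OF dist, of A] that
    by (simp add: I_def vimage_def Int_def conj_commute)
  have G_antimono: "G b \<le> G a" if "a \<le> b" for a b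
    unfolding G_def using that by (intro finite_measure_mono) auto
  have G_bounds: "0 \<le> G t" "G t \<le> 1" for t by (simp_all add: G_def)
  have G_low: "G t = 1" if "t \<le> \<alpha>" for t
  proof -
    have "emeasure M {\<omega> \<in> space M. X \<omega> \<in> {..<t}} = (\<integral>\<^sup>+t. 0 \<partial>(lborel :: real measure))"
      unfolding em[OF lessThan_borel] using that
      by (intro nn_integral_cong) (auto simp: I_iff split: split_indicator)
    then have "prob {\<omega> \<in> space M. X \<omega> < t} = 0" by (simp add: measure_def)
    moreover have "{\<omega> \<in> space M. t \<le> X \<omega>} = space M - {\<omega> \<in> space M. X \<omega> < t}" by auto
    ultimately show ?thesis unfolding G_def by (simp add: prob_compl)
  qed
  have G_high: "G t = 0" if "\<beta> \<le> ereal t" for t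
  proof -
    have "emeasure M {\<omega> \<in> space M. X \<omega> \<in> {t..}} = (\<integral>\<^sup>+t. 0 \<partial>(lborel :: real measure))"
      unfolding em[OF atLeast_borel]
    proof (rule nn_integral_cong_AE)
      show "AE x in lborel. ennreal (indicator I x * f x) * indicator {t..} x = 0"
        using AE_lborel_singleton[of t]
      proof eventually_elim
        case (elim x)
        have "x \<notin> I" if "t < x"
        proof -
          have "\<beta> < ereal x" using that \<open>\<beta> \<le> ereal t\<close> by (metis ereal_less(1) less_ereal.simps(1) order_le_less_trans)
          then show ?thesis by (auto simp: I_iff not_le)
        qed
        then show ?case using elim by (auto split: split_indicator)
      qed
    qed
    then show ?thesis by (simp add: G_def measure_def)
  qed
  have G_diff: "G a = integral {a..b} f + G b" if ab: "\<alpha> \<le> a" "a \<le> b" "ereal b \<le> \<beta>" for a b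
  proof -
    have sub: "{a..b} \<subseteq> I" using I_interval ab by auto
    have cont: "continuous_on {a..b} f"
      using f_cont sub unfolding I_def by (rule continuous_on_subset)
    have int: "set_integrable lborel {a..b} f"
      by (rule borel_integrable_atLeastAtMost') (rule cont)
    have nn: "0 \<le> indicator {a..b} x * f x" for x
      using sub f_pos[of x] by (auto simp: I_def split: split_indicator intro: less_imp_le)
    have "emeasure M {\<omega> \<in> space M. X \<omega> \<in> {a..<b}} = (\<integral>\<^sup>+x. ennreal (indicator {a..b} x * f x) \<partial>lborel)"
      unfolding em[OF atLeastLessThan_borel]
    proof (rule nn_integral_cong_AE)
      show "AE x in lborel. ennreal (indicator I x * f x) * indicator {a..<b} x = ennreal (indicator {a..b} x * f x)"
        using AE_lborel_singleton[of b] by eventually_elim (use sub in \<open>auto split: split_indicator\<close>)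
    qed
    also have "\<dots> = ennreal (\<integral>x. indicator {a..b} x * f x \<partial>lborel)"
      using int nn by (intro nn_integral_eq_integral) (auto simp: set_integrable_def)
    also have "(\<integral>x. indicator {a..b} x * f x \<partial>lborel) = integral {a..b} f"
      using set_borel_integral_eq_integral(2)[OF int] by (simp add: set_lebesgue_integral_def)
    finally have *: "emeasure M {\<omega> \<in> space M. X \<omega> \<in> {a..<b}} = ennreal (integral {a..b} f)" .
    have "0 \<le> f x" if "x \<in> {a..b}" for x
      using that sub f_pos[of x] by (auto simp: I_def intro: less_imp_le)
    then have "0 \<le> integral {a..b} f"
      by (intro Henstock_Kurzweil_Integration.integral_nonneg integrable_continuous_real cont)
    with * have "prob {\<omega> \<in> space M. X \<omega> \<in> {a..<b}} = integral {a..b} f" by (simp add: measure_def)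
    moreover have "{\<omega> \<in> space M. a \<le> X \<omega>} = {\<omega> \<in> space M. X \<omega> \<in> {a..<b}} \<union> {\<omega> \<in> space M. b \<le> X \<omega>}"
      using ab by auto
    ultimately show ?thesis
      unfolding G_def by (simp, subst finite_measure_Union) auto
  qed
  have G_deriv_within: "(G has_real_derivative - f x) (at x within {a..b})"
    if ab: "\<alpha> \<le> a" "ereal b \<le> \<beta>" "x \<in> {a..b}" for a b x
  proof -
    have "continuous_on {a..b} f"
      using f_cont I_interval[OF ab(1,2)] unfolding I_def by (rule continuous_on_subset)
    then have "((\<lambda>x. integral {x..b} f + G b) has_real_derivative - f x) (at x within {a..b})"
      using ab by (auto intro!: derivative_eq_intros integral_has_real_derivative')
    then show ?thesis
      by (rule has_field_derivative_transform_within[where d = 1])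
        (use G_diff ab in \<open>auto intro: G_diff[symmetric]\<close>)
  qed
  have J_nbhd: "\<exists>a b. \<alpha> < a \<and> a < t \<and> t < b \<and> ereal b < \<beta>" if "t \<in> J" for t
  proof -
    have "ereal t < \<beta>" "\<alpha> < t" using that by (auto simp: J_def)
    then show ?thesis
      using ereal_dense2[of "ereal t" \<beta>] dense[of \<alpha> t] by auto
  qed
  have G_deriv: "(G has_real_derivative - f t) (at t)" if t: "t \<in> J" for t
  proof -
    obtain a b where ab: "\<alpha> < a" "a < t" "t < b" "ereal b < \<beta>" using J_nbhd[OF t] by blast
    have "(G has_real_derivative - f t) (at t within {a..b})"
      using ab by (intro G_deriv_within) auto
    then have "(G has_real_derivative - f t) (at t within {a<..<b})"
      by (rule DERIV_subset) auto
    then show ?thesis using ab by (simp add: at_within_open[of t "{a<..<b}"])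
  qed
  have G_cont: "continuous_on {a..b} G" if "\<alpha> \<le> a" "ereal b \<le> \<beta>" for a b
    by (rule DERIV_continuous_on[OF G_deriv_within[OF that]])
  have G_strict: "G b < G a" if ab: "\<alpha> \<le> a" "a < b" "ereal b \<le> \<beta>" for a b
  proof (rule DERIV_neg_imp_decreasing_open[OF ab(2)])
    fix x assume x: "a < x" "x < b"
    then have "ereal x < ereal b" by simp
    then have "x \<in> J" using x ab by (auto simp: J_def simp del: less_ereal.simps)
    then show "\<exists>y. (G has_real_derivative y) (at x) \<and> y < 0"
      using G_deriv[of x] f_pos[of x] J_I unfolding I_def by (intro exI[of _ "- f x"]) auto
  qed (use G_cont ab in auto)
  have G_in: "G t \<in> {0<..<1}" if t: "t \<in> J" for t
  proof -
    obtain a b where ab: "\<alpha> < a" "a < t" "t < b" "ereal b < \<beta>" using J_nbhd[OF t] by blast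
    then have "G b < G t" "G t < G \<alpha>" using t by (auto intro!: G_strict simp: J_def)
    then show ?thesis using G_bounds[of b] G_low[of \<alpha>] by auto
  qed
  have ex: "\<exists>t\<in>J. G t = u" if u: "u \<in> {0<..<1}" for u
  proof -
    \<comment> \<open>A finite upper end of the support serves as \<open>b\<close>, as
      \<open>G\<close> vanishes there; otherwise the tail probability tends to 0 along the
      integers.\<close>
    obtain b where b: "\<alpha> \<le> b" "ereal b \<le> \<beta>" "G b \<le> u"
    proof (cases \<beta>)
      case (real b)
      then show ?thesis using that[of b] G_high[of b] u \<alpha> by auto
    next
      case PInf
      have "(\<lambda>n. prob {\<omega> \<in> space M. real n \<le> X \<omega>}) \<longlonglongrightarrow> prob (\<Inter>n. {\<omega> \<in> space M. real n \<le> X \<omega>})"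
        by (rule finite_Lim_measure_decseq) (auto simp: decseq_def)
      moreover have "(\<Inter>n. {\<omega> \<in> space M. real n \<le> X \<omega>}) = {}"
      proof -
        have "\<exists>n. \<not> real n \<le> X \<omega>" for \<omega> using reals_Archimedean2[of "X \<omega>"] by (auto simp: not_le)
        then show ?thesis by auto
      qed
      ultimately have "(\<lambda>n. G (real n)) \<longlonglongrightarrow> 0" by (simp add: G_def)
      then have "eventually (\<lambda>n. G (real n) < u) sequentially"
        using u by (intro order_tendstoD) auto
      moreover have "eventually (\<lambda>n. \<alpha> \<le> real n) sequentially"
        by (rule eventually_sequentiallyI[of "nat \<lceil>\<alpha>\<rceil>"]) linarith
      ultimately have "eventually (\<lambda>n. G (real n) < u \<and> \<alpha> \<le> real n) sequentially"
        by eventually_elim auto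
      then obtain n where "G (real n) < u" "\<alpha> \<le> real n"
        by (auto simp: eventually_sequentially)
      then show ?thesis using that[of "real n"] PInf by auto
    qed (use \<alpha> in auto)
    have "\<exists>t\<ge>\<alpha>. t \<le> b \<and> G t = u"
      using b u G_low[of \<alpha>] by (intro IVT2' G_cont) auto
    then obtain t where t: "\<alpha> \<le> t" "t \<le> b" "G t = u" by blast
    have "t \<noteq> \<alpha>" using t u G_low[of \<alpha>] by auto
    have "ereal t < \<beta>" using t u G_high[of t] by (auto simp: not_less[symmetric])
    moreover have "\<alpha> < t" using t \<open>t \<noteq> \<alpha>\<close> by linarith
    ultimately show ?thesis using t by (intro bexI[of _ t]) (auto simp: J_def)
  qed
  define c where "c u = (SOME t. t \<in> J \<and> G t = u)" for u
  have c: "c u \<in> J" "G (c u) = u" if "u \<in> {0<..<1}" for u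
    using someI_ex[of "\<lambda>t. t \<in> J \<and> G t = u"] ex[OF that] unfolding c_def by auto
  have c_strict: "c w < c u" if "0 < u" "u < w" "w < 1" for u w
  proof (rule ccontr)
    assume "\<not> c w < c u"
    then have "G (c w) \<le> G (c u)" by (intro G_antimono) auto
    then show False using c[of u] c[of w] that by auto
  qed
  have c_G: "c (G t) = t" if t: "t \<in> J" for t
  proof -
    have "c (G t) \<in> J" "G (c (G t)) = G t" using c[OF G_in[OF t]] by auto
    moreover from this t have "ereal (c (G t)) \<le> \<beta>" "ereal t \<le> \<beta>"
      by (auto simp: J_def less_imp_le)
    ultimately show ?thesis
      using G_strict[of t "c (G t)"] G_strict[of "c (G t)" t] t
      by (cases "c (G t)" t rule: linorder_cases) (auto simp: J_def)
  qed
  have c_image: "c ` {0<..<1} = J"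
  proof (intro equalityI subsetI)
    fix t assume "t \<in> J"
    then have "t = c (G t)" "G t \<in> {0<..<1}" using c_G G_in by simp_all
    then show "t \<in> c ` {0<..<1}" by (rule image_eqI)
  qed (use c(1) in blast)
  have "open J"
  proof -
    have "J = {\<alpha><..} \<inter> ereal -` {..<\<beta>}" by (auto simp: J_def)
    then show ?thesis by (simp add: open_Int open_vimage continuous_on_ereal)
  qed
  have c_anti: "c w \<le> c u" if "0 < u" "u \<le> w" "w < 1" for u w
    using c_strict[of u w] that by (cases "u = w") auto
  have c_cont: "continuous_on {0<..<1} c"
  proof -
    \<comment> \<open>A monotone function with open image cannot jump; the negation makes
      \<open>c\<close> increasing.\<close>
    have "(\<lambda>u. - c u) ` {0<..<1} = uminus ` J" unfolding c_image[symmetric] by (simp add: image_image)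
    then have "continuous_on {0<..<1} (\<lambda>u. - c u)"
      using open_negations[OF \<open>open J\<close>] c_anti by (intro continuous_onI_mono) auto
    then have "continuous_on {0<..<1} (\<lambda>u. - (- c u))" by (rule continuous_on_minus)
    then show ?thesis by simp
  qed
  define \<psi> where "\<psi> u = c u - u / f (c u)" for u
  have f_c_pos: "0 < f (c u)" if "u \<in> {0<..<1}" for u
    using c(1)[OF that] J_I f_pos by (auto simp: I_def)
  have c_deriv: "(c has_real_derivative (\<psi> u - c u) / u) (at u)" if u: "0 < u" "u < 1" for u
  proof -
    have "(c has_real_derivative inverse (- f (c u))) (at u)"
    proof (rule DERIV_inverse_function[where f = G and a = 0 and b = 1])
      show "(G has_real_derivative - f (c u)) (at (c u))" using c[of u] u by (intro G_deriv) auto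
      show "isCont c u" using c_cont u by (simp add: continuous_on_eq_continuous_at)
    qed (use u c f_c_pos[of u] in auto)
    then show ?thesis using u f_c_pos[of u] by (simp add: \<psi>_def field_simps)
  qed
  have \<psi>_anti: "\<psi> w \<le> \<psi> u" if "0 < u" "u \<le> w" "w < 1" for u w
  proof -
    have "c w \<in> I" "c u \<in> I" using c[of u] c[of w] that J_I by auto
    then have "c w - G (c w) / f (c w) \<le> c u - G (c u) / f (c u)"
      using mono_onD[OF \<phi>_mono, of "c w" "c u"] c_anti[OF that] by (simp add: G_def I_def)
    then show ?thesis using that c[of u] c[of w] by (simp add: \<psi>_def)
  qed
  have "continuous_on {0<..<1} (\<lambda>u. f (c u))"
    by (rule continuous_on_compose2[OF f_cont c_cont]) (use c_image J_I in \<open>auto simp: I_def\<close>)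
  then have \<psi>_cont: "continuous_on {0<..<1} \<psi>"
    unfolding \<psi>_def [abs_def] using f_c_pos c_cont
    by (intro continuous_intros) (auto simp: less_imp_neq[THEN not_sym])
  \<comment> \<open>The revenue curve \<open>u * c u\<close> has the decreasing derivative
    \<open>\<psi>\<close>, so it lies below its tangent at 1/2, which on the unit interval exceeds
    its value there by at most \<open>\<bar>\<psi> (1/2)\<bar>\<close>. Any finite bound would do at
    this point.\<close>
  define r where "r = 1/2 * c (1/2) + \<bar>\<psi> (1/2)\<bar>"
  have R_deriv: "((\<lambda>u. u * c u) has_real_derivative \<psi> u) (at u)" if "0 < u" "u < 1" for u
    by (rule derivative_eq_intros c_deriv that refl)+ (use that in \<open>simp add: field_simps\<close>)
  have revenue: "u * c u \<le> r" if u: "0 < u" "u < 1" for u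
  proof -
    have slope: "\<bar>d * \<psi> (1/2)\<bar> \<le> \<bar>\<psi> (1/2)\<bar>" if "\<bar>d\<bar> \<le> 1" for d
      using that by (simp add: abs_mult mult_left_le_one_le)
    consider "u < 1/2" | "u = 1/2" | "1/2 < u" by linarith
    then show ?thesis
    proof cases
      case 1
      obtain z where z: "u < z" "z < 1/2" "1/2 * c (1/2) - u * c u = (1/2 - u) * \<psi> z"
        using MVT2[of u "1/2" "\<lambda>u. u * c u" \<psi>] R_deriv u 1 by fastforce
      have "(1/2 - u) * \<psi> (1/2) \<le> (1/2 - u) * \<psi> z"
        using \<psi>_anti[of z "1/2"] z u by (intro mult_left_mono) auto
      moreover have "- \<bar>\<psi> (1/2)\<bar> \<le> (1/2 - u) * \<psi> (1/2)"
        using slope[of "1/2 - u"] u 1 by linarith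
      ultimately show ?thesis unfolding r_def using z(3) by linarith
    next
      case 3
      obtain z where z: "1/2 < z" "z < u" "u * c u - 1/2 * c (1/2) = (u - 1/2) * \<psi> z"
        using MVT2[of "1/2" u "\<lambda>u. u * c u" \<psi>] R_deriv u 3 by fastforce
      have "(u - 1/2) * \<psi> z \<le> (u - 1/2) * \<psi> (1/2)"
        using \<psi>_anti[of "1/2" z] z u by (intro mult_left_mono) auto
      moreover have "(u - 1/2) * \<psi> (1/2) \<le> \<bar>\<psi> (1/2)\<bar>"
        using slope[of "u - 1/2"] u 3 by linarith
      ultimately show ?thesis unfolding r_def using z(3) by linarith
    next
      case 2
      show ?thesis unfolding r_def 2 by simp
    qed
  qed
  interpret regular_quantile c \<psi> r
  proof
    show "0 \<le> c u" if "0 < u" "u < 1" for u using c(1)[of u] that \<alpha> by (auto simp: J_def)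
  qed (use c_strict c_deriv \<psi>_anti \<psi>_cont revenue in auto)
  \<comment> \<open>Valid for every real \<open>t\<close>, also outside the support, so it
    determines the law of \<open>c\<close> on all half-lines.\<close>
  have galois: "t \<le> c u \<longleftrightarrow> u \<le> G t" if u: "u \<in> {0<..<1}" for t u
  proof
    assume "t \<le> c u"
    then show "u \<le> G t" using G_antimono c(2)[OF u] by metis
  next
    assume le: "u \<le> G t"
    show "t \<le> c u"
    proof (rule ccontr)
      assume less: "\<not> t \<le> c u"
      have "G t < u"
      proof (cases "ereal t \<le> \<beta>")
        case True
        then show ?thesis using G_strict[of "c u" t] c[OF u] less by (auto simp: J_def)
      qed (use G_high[of t] u in auto)
      then show False using le by simp
    qed
  qed
  have "distr unif borel c = distr M borel X"
  proof (rule measure_eqI_atLeast)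
    show "prob_space (distr unif borel c)" by (rule unif.prob_space_distr) simp
    fix t :: real
    have "emeasure (distr unif borel c) {t..} = emeasure unif {u \<in> space unif. u \<le> G t}"
      using galois by (subst emeasure_distr) (auto intro!: arg_cong[where f = "emeasure unif"])
    also have "\<dots> = emeasure lborel {u \<in> {0<..<1}. u \<le> G t}"
      by (subst emeasure_restrict_space) auto
    also have "\<dots> = ennreal (G t)"
    proof (cases "G t = 1")
      case True
      then have "{u \<in> {0<..<1}. u \<le> G t} = {0<..<1}" by auto
      then show ?thesis using True by simp
    next
      case False
      then have "{u \<in> {0<..<1}. u \<le> G t} = {0<..G t}" using G_bounds[of t] by auto
      then show ?thesis using G_bounds[of t] by simp
    qed
    also have "\<dots> = emeasure (distr M borel X) {t..}"
      by (subst emeasure_distr) (auto simp: G_def emeasure_eq_measure vimage_def Int_def conj_commute)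
    finally show "emeasure (distr unif borel c) {t..} = emeasure (distr M borel X) {t..}" .
  qed auto
  then show ?thesis using regular_quantile_axioms by blast
qed

section \<open>Posted prices and separate revenue\<close>

lemma borel_measurable_vec_nth [measurable]: "(\<lambda>x::real^'n. x $ i) \<in> borel_measurable borel"
  by (intro borel_measurable_continuous_onI continuous_intros)

lemma posted_price_mechanism:
  fixes p :: real and i :: "'n::finite"
  assumes p: "0 \<le> p"
  defines "q \<equiv> \<lambda>x::real^'n. \<chi> j. if j = i \<and> p \<le> x $ i then 1 else 0"
    and "s \<equiv> \<lambda>x::real^'n. if p \<le> x $ i then p else 0"
  shows "mechanism q s \<and> IC q s \<and> IR q s"
proof -
  have inner: "q x \<bullet> y = (if p \<le> x $ i then y $ i else 0)" for x y
  proof -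
    have "q x \<bullet> y = (\<Sum>j\<in>UNIV. if j = i then (if p \<le> x $ i then y $ i else 0) else 0)"
      unfolding inner_vec_def q_def by (intro sum.cong) auto
    then show ?thesis by simp
  qed
  have "q = (\<lambda>x. if p \<le> x $ i then axis i 1 else 0)"
    unfolding q_def by (auto simp: fun_eq_iff vec_eq_iff axis_def)
  then have "q \<in> borel_measurable borel" by simp
  moreover have "s \<in> borel_measurable borel" unfolding s_def by simp
  ultimately show ?thesis
    unfolding mechanism_def IC_def IR_def buyer_payoff_def inner
    by (auto simp: q_def s_def)
qed

text \<open>Posted prices show that the set under the supremum is nonempty, that single-good revenue
  is at least \<open>u * c u\<close>, and that the joint revenue is positive.\<close>

lemma posted_price_revenue:
  fixes D :: "(real^'n) measure"
  assumes "prob_space D" and sets [measurable_cong]: "sets D = sets borel" and "0 \<le> p"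
  shows "p * measure D {x. p \<le> x $ i}
    \<in> {integral\<^sup>L D s | q s. mechanism q s \<and> IC q s \<and> IR q s \<and> integrable D s}"
proof -
  interpret prob_space D by fact
  let ?s = "\<lambda>x::real^'n. if p \<le> x $ i then p else 0"
  have [measurable]: "{x. p \<le> x $ i} \<in> sets D" unfolding sets by measurable
  have s: "?s = (\<lambda>x. p * indicator {x. p \<le> x $ i} x)" by (auto simp: fun_eq_iff)
  have "integrable D ?s"
    unfolding s by (intro integrable_mult_right integrable_real_indicator) (auto simp: less_top[symmetric])
  moreover have "integral\<^sup>L D ?s = p * measure D {x. p \<le> x $ i}" unfolding s by simp
  ultimately show ?thesis
    using posted_price_mechanism[OF \<open>0 \<le> p\<close>, of i]
    by (intro CollectI exI[of _ "\<lambda>x. \<chi> j. if j = i \<and> p \<le> x $ i then 1 else 0"] exI[of _ ?s]) simp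
qed

section \<open>Revenue of one good in quantile terms\<close>

context regular_quantile
begin

lemma prob_ge_quantile:
  assumes "distr unif borel c = distr M borel Z" "Z \<in> borel_measurable M" "0 < u" "u < 1"
  shows "u \<le> measure M {\<omega> \<in> space M. c u \<le> Z \<omega>}"
proof -
  have "u = measure lborel {0<..u}" using assms by simp
  also have "\<dots> = measure unif {0<..u}"
    using assms by (subst measure_restrict_space) auto
  also have "\<dots> \<le> measure unif (c -` {c u..} \<inter> space unif)"
    using assms c_anti by (intro unif.finite_measure_mono measurable_sets[OF c_measurable]) auto
  also have "\<dots> = measure (distr unif borel c) {c u..}"
    by (rule measure_distr[symmetric]) auto
  also have "\<dots> = measure M {\<omega> \<in> space M. c u \<le> Z \<omega>}"
    unfolding assms(1) using assms(2) by (subst measure_distr) (auto simp: vimage_def Int_def conj_commute)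
  finally show ?thesis .
qed

text \<open>Serves only to make the supremum in \<open>Rev\<close> a bounded one, so a crude
  constant is enough: \<open>r\<close> from the quantiles up to 1/2 by the grid bound, and
  \<open>2 * r\<close> from the rest, where the payment is at most \<open>c (1/2)\<close>.\<close>

lemma single_good_revenue_le:
  assumes int: "integrable unif S"
    and IR: "\<And>u. u \<in> {0<..<1} \<Longrightarrow> S u \<le> Q u * c u"
    and IC: "\<And>u w. \<lbrakk>u \<in> {0<..<1}; w \<in> {0<..<1}\<rbrakk> \<Longrightarrow> Q w * c u - S w \<le> Q u * c u - S u"
    and Q: "\<And>u. u \<in> {0<..<1} \<Longrightarrow> 0 \<le> Q u \<and> Q u \<le> 1"
  shows "(\<integral>u. S u \<partial>unif) \<le> 3 * r"
proof -
  have Q_anti: "Q w \<le> Q u" if "0 < u" "u \<le> w" "w < 1" for u w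
  proof (cases "u = w")
    case False
    then have "c w < c u" using that by (intro c_strict_anti) auto
    moreover have "0 \<le> (Q u - Q w) * (c u - c w)"
      using IC[of u w] IC[of w u] that by (simp add: algebra_simps)
    ultimately show ?thesis by (simp add: zero_le_mult_iff)
  qed simp
  have sub: "{0<..1/2} \<subseteq> {0<..<1::real}" "{1/2<..<1} \<subseteq> {0<..<1::real}" by auto
  have S_meas: "S \<in> borel_measurable unif" using int by auto
  have ind_int: "integrable unif (\<lambda>u. indicator A u * S u)" if "A \<in> sets borel" for A
  proof (rule Bochner_Integration.integrable_bound[OF int])
    have "(indicator A :: real \<Rightarrow> real) \<in> borel_measurable unif"
      by (rule measurable_restrict_space1) (use that in simp)
    then show "(\<lambda>u. indicator A u * S u) \<in> borel_measurable unif"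
      using S_meas by (rule borel_measurable_times)
  qed (auto split: split_indicator)
  have "(\<integral>u. S u \<partial>unif) = (\<integral>u. indicator {0<..1/2} u * S u + indicator {1/2<..<1} u * S u \<partial>unif)"
    by (intro Bochner_Integration.integral_cong) (auto split: split_indicator)
  also have "\<dots> = (\<integral>u. indicator {0<..1/2} u * S u \<partial>unif) + (\<integral>u. indicator {1/2<..<1} u * S u \<partial>unif)"
    by (intro Bochner_Integration.integral_add ind_int) auto
  also have "(\<integral>u. indicator {0<..1/2} u * S u \<partial>unif) = (LINT u:{0<..1/2}|lborel. S u)"
    by (rule unif_set_integral[OF sub(1)])
  also have "\<dots> \<le> 1/2 * S (1/2) + r * (1 - Q (1/2))"
  proof (rule antitone_payment_bound[where c = c])
    fix u w :: real assume uw: "0 < u" "u \<le> w" "w \<le> 1/2"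
    show "S u \<le> S w + (Q u - Q w) * c u"
      using IC[of u w] uw by (simp add: algebra_simps)
    show "Q w \<le> Q u" using Q_anti uw by auto
    then have "0 \<le> (Q u - Q w) * c w" using c_nonneg[of w] uw by auto
    then show "S w \<le> S u" using IC[of w u] uw by (simp add: algebra_simps)
  next
    show "set_integrable lborel {0<..1/2} S"
      using ind_int[of "{0<..1/2}"] by (simp add: unif_set_integrable[OF sub(1)])
  qed (use Q revenue_le r_nonneg in auto)
  also have "\<dots> \<le> r"
  proof -
    have "1/2 * S (1/2) \<le> Q (1/2) * (1/2 * c (1/2))" using IR[of "1/2"] by simp
    also have "\<dots> \<le> Q (1/2) * r" using Q[of "1/2"] revenue_le[of "1/2"] by (intro mult_left_mono) auto
    finally show ?thesis by (simp add: algebra_simps)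
  qed
  also have "(\<integral>u. indicator {1/2<..<1} u * S u \<partial>unif) \<le> (\<integral>u. 2 * r \<partial>unif)"
  proof (rule integral_mono[OF ind_int])
    fix u assume "u \<in> space unif"
    then have u: "u \<in> {0<..<1}" by simp
    show "indicator {1/2<..<1} u * S u \<le> 2 * r"
    proof (cases "1/2 < u")
      case True
      have "S u \<le> c u" using IR[OF u] Q[OF u] c_nonneg[of u] u
        by (auto intro: order_trans[OF _ mult_left_le_one_le])
      also have "c u \<le> c (1/2)" using True u by (intro c_anti) auto
      also have "\<dots> \<le> 2 * r" using revenue_le[of "1/2"] by simp
      finally show ?thesis using True u by simp
    qed (use r_nonneg in simp)
  qed auto
  also have "(\<integral>u. 2 * r \<partial>unif) = 2 * r" using unif.prob_space by simp
  finally show ?thesis by simp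
qed

text \<open>The price \<open>c u\<close> sells with probability at least \<open>u\<close>. Since
  \<open>Rev\<close> is a supremum of reals, boundedness must be settled before a member can be
  compared with it.\<close>

lemma Rev_single_ge:
  assumes "prob_space M" and Z [measurable]: "Z \<in> borel_measurable M"
    and distr: "distr unif borel c = distr M borel Z"
    and u: "0 < u" "u < 1"
  shows "u * c u \<le> Rev (distr M borel (\<lambda>\<omega>. (\<chi> j::1. Z \<omega>)))"
proof -
  interpret prob_space M by fact
  let ?vec = "\<lambda>x. (\<chi> j::1. x) :: real^1"
  let ?D = "distr M borel (\<lambda>\<omega>. ?vec (Z \<omega>))"
  have vec [measurable]: "?vec \<in> borel_measurable borel"
    by (intro borel_measurable_continuous_onI continuous_intros)
  have D: "?D = distr unif borel (\<lambda>u. ?vec (c u))"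
    using distr_distr[OF vec Z] distr_distr[OF vec c_measurable] by (simp add: distr comp_def)
  let ?R = "{integral\<^sup>L ?D s | q s. mechanism q s \<and> IC q s \<and> IR q s \<and> integrable ?D s}"
  have "bdd_above ?R"
  proof (rule bdd_aboveI)
    fix x assume "x \<in> ?R"
    then obtain q s where qs: "mechanism q s" "IC q s" "IR q s" "integrable ?D s" "x = integral\<^sup>L ?D s"
      by blast
    have [measurable]: "s \<in> borel_measurable borel" using qs(1) by (simp add: mechanism_def)
    have inner: "y \<bullet> ?vec t = y $ 1 * t" for y t by (simp add: inner_vec_def)
    have orthant: "?vec (c u) \<in> nonneg_orthant" if "u \<in> {0<..<1}" for u
      using that c_nonneg by (auto simp: nonneg_orthant_def)
    have "(\<integral>u. s (?vec (c u)) \<partial>unif) \<le> 3 * r"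
    proof (rule single_good_revenue_le[where Q = "\<lambda>u. q (?vec (c u)) $ 1"])
      show "integrable unif (\<lambda>u. s (?vec (c u)))"
        using qs(4) unfolding D by (subst (asm) integrable_distr_eq) auto
      fix u :: real assume u: "u \<in> {0<..<1}"
      show "s (?vec (c u)) \<le> q (?vec (c u)) $ 1 * c u"
        using qs(3) orthant[OF u] by (auto simp: IR_def buyer_payoff_def inner)
      show "0 \<le> q (?vec (c u)) $ 1 \<and> q (?vec (c u)) $ 1 \<le> 1"
        using qs(1) by (simp add: mechanism_def)
      fix w :: real assume w: "w \<in> {0<..<1}"
      show "q (?vec (c w)) $ 1 * c u - s (?vec (c w)) \<le> q (?vec (c u)) $ 1 * c u - s (?vec (c u))"
        using qs(2) orthant[OF u] orthant[OF w] by (auto simp: IC_def buyer_payoff_def inner)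
    qed
    then show "x \<le> 3 * r"
      unfolding qs(5) D by (subst integral_distr) auto
  qed
  moreover have "c u * measure ?D {x. c u \<le> x $ 1} \<in> ?R"
    using u by (intro posted_price_revenue c_nonneg prob_space_distr) auto
  ultimately have "c u * measure ?D {x. c u \<le> x $ 1} \<le> Rev ?D"
    unfolding Rev_def by (rule cSup_upper[rotated])
  moreover have "measure ?D {x. c u \<le> x $ 1} = measure M {\<omega> \<in> space M. c u \<le> Z \<omega>}"
    by (subst measure_distr) (auto simp: vimage_def Int_def conj_commute)
  moreover have "c u * u \<le> c u * measure M {\<omega> \<in> space M. c u \<le> Z \<omega>}"
    using u c_nonneg by (intro mult_left_mono prob_ge_quantile distr Z) auto
  ultimately show ?thesis by (simp add: mult.commute)
qed

text \<open>Lets the ad hoc bound from \<open>weakly_regular_quantile\<close> be exchanged for the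
  optimal revenue of the good.\<close>

lemma regular_quantile_revenue:
  assumes "\<And>u. \<lbrakk>0 < u; u < 1\<rbrakk> \<Longrightarrow> u * c u \<le> r'"
  shows "regular_quantile c \<psi> r'"
  using c_nonneg c_strict_anti c_deriv \<psi>_anti \<psi>_continuous assms by unfold_locales auto

end

section \<open>Joint against separate revenue\<close>

theorem theorem2:
  fixes M :: "'a measure" and X :: "'a \<Rightarrow> real^2"
  assumes "prob_space M"
    and "X \<in> borel_measurable M"
    and "prob_space.indep_var M borel (\<lambda>\<omega>. X \<omega> $ 1) borel (\<lambda>\<omega>. X \<omega> $ 2)"
    and "weakly_regular M (\<lambda>\<omega>. X \<omega> $ 1)"
    and "weakly_regular M (\<lambda>\<omega>. X \<omega> $ 2)"
  shows "SRev M X / Rev (distr M borel X) \<ge> exp 1 / (exp 1 + 1)"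
proof -
  interpret prob_space M by fact
  note X [measurable] = assms(2)
  let ?X1 = "\<lambda>\<omega>. X \<omega> $ 1" and ?X2 = "\<lambda>\<omega>. X \<omega> $ 2"
  have X1 [measurable]: "?X1 \<in> borel_measurable M" and X2 [measurable]: "?X2 \<in> borel_measurable M"
    by measurable
  define R1 where "R1 = Rev (distr M borel (\<lambda>\<omega>. (\<chi> j::1. X \<omega> $ 1)))"
  define R2 where "R2 = Rev (distr M borel (\<lambda>\<omega>. (\<chi> j::1. X \<omega> $ 2)))"
  have SRev: "SRev M X = R1 + R2" by (simp add: SRev_def sum_2 R1_def R2_def)
  obtain c1 \<psi>1 r1 c2 \<psi>2 r2 where rq: "regular_quantile c1 \<psi>1 r1" "regular_quantile c2 \<psi>2 r2"
    and d1: "distr unif borel c1 = distr M borel ?X1" and d2: "distr unif borel c2 = distr M borel ?X2"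
    using weakly_regular_quantile[OF assms(1,4)] weakly_regular_quantile[OF assms(1,5)] by blast
  interpret good1: regular_quantile c1 \<psi>1 R1
    unfolding R1_def
    by (intro regular_quantile.regular_quantile_revenue[OF rq(1)]
        regular_quantile.Rev_single_ge[OF rq(1) assms(1) X1 d1])
  interpret good2: regular_quantile c2 \<psi>2 R2
    unfolding R2_def
    by (intro regular_quantile.regular_quantile_revenue[OF rq(2)]
        regular_quantile.Rev_single_ge[OF rq(2) assms(1) X2 d2])
  define vec where "vec p = ((\<chi> i::2. if i = 1 then fst p else snd p) :: real^2)" for p
  have vec_nth: "vec p $ 1 = fst p" "vec p $ 2 = snd p" for p by (simp_all add: vec_def)
  have inner: "y \<bullet> vec (a, b) = y $ 1 * a + y $ 2 * b" for y a b
    by (simp add: inner_vec_def sum_2 vec_nth)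
  have vec_meas [measurable]: "vec \<in> borel_measurable (borel \<Otimes>\<^sub>M borel)"
  proof -
    have "continuous_on UNIV (\<lambda>p. if i = 1 then fst p else snd p :: real)" for i :: 2
      by (cases "i = 1") (auto intro!: continuous_intros)
    then have "vec \<in> borel_measurable borel"
      unfolding vec_def [abs_def] by (intro borel_measurable_continuous_onI continuous_on_vec_lambda)
    then show ?thesis by (simp add: borel_prod)
  qed
  have X_vec: "X \<omega> = vec (X \<omega> $ 1, X \<omega> $ 2)" for \<omega>
    by (simp add: vec_eq_iff forall_2 vec_nth)
  let ?P = "unif \<Otimes>\<^sub>M unif" and ?c = "\<lambda>(u, v). (c1 u, c2 v)"
  have c_meas [measurable]: "?c \<in> ?P \<rightarrow>\<^sub>M borel \<Otimes>\<^sub>M borel" by measurable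
  have joint: "distr M (borel \<Otimes>\<^sub>M borel) (\<lambda>\<omega>. (X \<omega> $ 1, X \<omega> $ 2)) = distr ?P (borel \<Otimes>\<^sub>M borel) ?c"
  proof -
    have "distr M (borel \<Otimes>\<^sub>M borel) (\<lambda>\<omega>. (X \<omega> $ 1, X \<omega> $ 2)) = distr M borel ?X1 \<Otimes>\<^sub>M distr M borel ?X2"
      using assms(3) by (simp add: indep_var_distribution_eq)
    also have "\<dots> = distr ?P (borel \<Otimes>\<^sub>M borel) ?c"
      unfolding d1[symmetric] d2[symmetric]
      by (intro pair_measure_distr prob_space_imp_sigma_finite unif.prob_space_distr) auto
    finally show ?thesis .
  qed
  \<comment> \<open>Independence makes the law of \<open>X\<close> the image of the uniform measure
    on the square, which carries every mechanism over to quantile coordinates.\<close>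
  let ?D = "distr M borel X"
  have D: "?D = distr ?P borel (\<lambda>p. vec (?c p))"
  proof -
    have "?D = distr (distr M (borel \<Otimes>\<^sub>M borel) (\<lambda>\<omega>. (X \<omega> $ 1, X \<omega> $ 2))) borel vec"
      by (subst distr_distr) (auto simp: comp_def X_vec[symmetric])
    also have "\<dots> = distr ?P borel (\<lambda>p. vec (?c p))"
      unfolding joint by (subst distr_distr) (auto simp: comp_def)
    finally show ?thesis .
  qed
  let ?R = "{integral\<^sup>L ?D s | q s. mechanism q s \<and> IC q s \<and> IR q s \<and> integrable ?D s}"
  have upper: "x \<le> (1 + 1 / exp 1) * (R1 + R2)" if x: "x \<in> ?R" for x
  proof -
    obtain q s where qs: "mechanism q s" "IC q s" "IR q s" "integrable ?D s" "x = integral\<^sup>L ?D s"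
      using x by blast
    have [measurable]: "s \<in> borel_measurable borel" "q \<in> borel_measurable borel"
      using qs(1) by (simp_all add: mechanism_def)
    have q_bounds: "0 \<le> q x $ i" "q x $ i \<le> 1" for x i
      using qs(1) by (simp_all add: mechanism_def)
    have orthant: "vec (c1 u, c2 v) \<in> nonneg_orthant" if "u \<in> {0<..<1}" "v \<in> {0<..<1}" for u v
      using that good1.c_nonneg good2.c_nonneg by (auto simp: nonneg_orthant_def forall_2 vec_nth)
    interpret two_good_mechanism c1 \<psi>1 R1 c2 \<psi>2 R2 "\<lambda>u v. q (vec (c1 u, c2 v)) $ 1"
      "\<lambda>u v. q (vec (c1 u, c2 v)) $ 2" "\<lambda>u v. s (vec (c1 u, c2 v))"
    proof unfold_locales
      have [measurable]: "(\<lambda>p. q (vec (?c p)) $ i) \<in> borel_measurable ?P" for i by measurable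
      then show "(\<lambda>(u, v). q (vec (c1 u, c2 v)) $ 1) \<in> borel_measurable ?P"
        "(\<lambda>(u, v). q (vec (c1 u, c2 v)) $ 2) \<in> borel_measurable ?P"
        by (simp_all add: split_beta')
      have "integrable ?P (\<lambda>p. s (vec (?c p)))"
        using qs(4) unfolding D by (subst (asm) integrable_distr_eq) auto
      then show "integrable ?P (\<lambda>(u, v). s (vec (c1 u, c2 v)))"
        by (simp add: split_beta')
      fix u v u' v' :: real assume I: "u \<in> {0<..<1}" "v \<in> {0<..<1}"
      show "0 \<le> q (vec (c1 u, c2 v)) $ 1 * c1 u + q (vec (c1 u, c2 v)) $ 2 * c2 v - s (vec (c1 u, c2 v))"
        using qs(3) orthant[OF I] by (auto simp: IR_def buyer_payoff_def inner)
      assume I': "u' \<in> {0<..<1}" "v' \<in> {0<..<1}"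
      show "q (vec (c1 u', c2 v')) $ 1 * c1 u + q (vec (c1 u', c2 v')) $ 2 * c2 v - s (vec (c1 u', c2 v'))
          \<le> q (vec (c1 u, c2 v)) $ 1 * c1 u + q (vec (c1 u, c2 v)) $ 2 * c2 v - s (vec (c1 u, c2 v))"
        using qs(2) orthant[OF I] orthant[OF I'] by (auto simp: IC_def buyer_payoff_def inner)
    qed (use q_bounds in auto)
    have "x = (\<integral>p. s (vec (?c p)) \<partial>?P)"
      unfolding qs(5) D by (rule integral_distr) auto
    then show ?thesis using revenue_bound by (simp add: split_beta')
  qed
  \<comment> \<open>Division by zero is zero in HOL, so the bound on the quotient requires a
    positive denominator; a price at the median of good 1 provides it.\<close>
  have "0 < Rev ?D"
  proof -
    let ?p = "c1 (1/2)"
    have p: "0 < ?p" using good1.c_strict_anti[of "1/2" "3/4"] good1.c_nonneg[of "3/4"] by simp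
    have mem: "?p * measure ?D {x. ?p \<le> x $ 1} \<in> ?R"
      using p by (intro posted_price_revenue prob_space_distr) auto
    have "1/2 \<le> measure M {\<omega> \<in> space M. ?p \<le> X \<omega> $ 1}"
      by (rule good1.prob_ge_quantile[OF d1 X1]) auto
    also have "\<dots> = measure ?D {x. ?p \<le> x $ 1}"
      by (subst measure_distr) (auto simp: vimage_def Int_def conj_commute)
    finally have "0 < ?p * measure ?D {x. ?p \<le> x $ 1}" using p by simp
    also have "\<dots> \<le> Rev ?D"
      unfolding Rev_def using upper by (intro cSup_upper[OF mem] bdd_aboveI)
    finally show ?thesis .
  qed
  moreover have "Rev ?D \<le> (1 + 1 / exp 1) * (R1 + R2)"
  proof -
    have "0 * measure ?D {x. 0 \<le> x $ 1} \<in> ?R"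
      by (intro posted_price_revenue prob_space_distr) auto
    then have "?R \<noteq> {}" by blast
    then show ?thesis unfolding Rev_def using upper by (intro cSup_least)
  qed
  then have "exp 1 / (exp 1 + 1) * Rev ?D \<le> R1 + R2"
    by (simp add: field_simps add_pos_pos)
  ultimately show ?thesis
    unfolding SRev by (simp add: pos_le_divide_eq)
qed

end
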